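(* Let $D$ be a basic set of size $k$ in $\Sigma^+$. Then: (i) $\Delta_D$ is closed and $\langle X_\alpha:\alpha\in\Delta_D\rangle$ is isomorphic to $U_k(q)$. (ii) $\Gamma_D$ is closed. For each pair $i<j$, if $\gamma_{i,s}$ and $\gamma_{j,r}$ exist and $\gamma_{i,s}+\gamma_{j,r}\in\Sigma^+$, then $s=j$ and $\gamma_{i,j}+\gamma_{j,r}=\gamma_{i,r}$. (iii) $\Lambda_D$ is closed. For each pair $i<j$, if $\nu_{i,s}$ and $\nu_{j,r}$ exist and $\nu_{i,s}+\nu_{j,r}\in\Sigma^+$, then $s=j$ and $\nu_{i,j}+\nu_{j,r}=\nu_{i,r}$. (iv) $R_D$ is isomorphic to $U_k(q)\cap {}^{w_D}U_k(q)$, and $C_D$ is isomorphic to $U_k(q)\cap{}^{w_0w_D}U_k(q)$, where $w_0$ is the longest element of the Weyl group $S_k$ of $\mathrm{GL}_k(q)$, i.e. the $k\times k$ permutation matrix with ones on the antidiagonal and zeros elsewhere. (v) $V_DR_D$ is a pattern subgroup of $U$ and $R_D$ normalizes $V_D$.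
   Context: Let $q$ be a power of a prime, $\mathbb{F}_q$ the field with $q$ elements, $n\ge 2$, and for any $m\ge1$ let $U_m(q)$ be the group of upper triangular $m\times m$ matrices over $\mathbb{F}_q$ with all diagonal entries $1$; put $U=U_n(q)$. For $w\in\mathrm{GL}_k(q)$, ${}^wU_k(q)=w\,U_k(q)\,w^{-1}$. The Weyl group $S_k$ is identified with the permutation matrices in $\mathrm{GL}_k(q)$. Let $\alpha_1,\dots,\alpha_{n-1}$ be the simple roots of type $A_{n-1}$, $\alpha_{i,j}=\alpha_i+\alpha_{i+1}+\dots+\alpha_j$ for $1\le i\le j\le n-1$, and $\Sigma^+=\{\alpha_{i,j}\}$ the set of positive roots. Thus the sum of two positive roots is a positive root exactly in the case $\alpha_{i,j}+\alpha_{j+1,k}=\alpha_{i,k}$. The root $\alpha_{i,j}$ lies on row $i$ and column $j+1$. The root subgroup is $X_{\alpha_{i,j}}=\{I_n+c\,e_{i,j+1}: c\in\mathbb{F}_q\}$, where $e_{i,j+1}$ is the matrix unit. A subset $S\subset\Sigma^+$ is closed if $\alpha,\beta\in S$ and $\alpha+\beta\in\Sigma^+$ imply $\alpha+\beta\in S$. A pattern subgroup of $U$ is a subgroup generated by all $X_\alpha$, $\alpha\in S$, for some closed $S\subset\Sigma^+$. Put $arm(\alpha_{i,j})=\{\alpha_{i,k}: i\le k<j\}$. A basic set $D$ is a nonempty subset of $\Sigma^+$ in which no two distinct roots are on the same row or on the same column. For a basic set $D$ let $V_D=\langle X_\beta:\beta\in\Sigma^+\setminus\bigcup_{\alpha\in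 D}arm(\alpha)\rangle$. Write $\alpha_{i,j}<_r\alpha_{l,k}$ if $j<k$ and $\alpha_{i,j}<_b\alpha_{l,k}$ if $i<l$; both are total orders on a basic set. Let $D=\{\tau_1,\dots,\tau_k\}$ with $\tau_1<_r\dots<_r\tau_k$. Define $w_D=(a_{i,j})\in\mathrm{GL}_k(q)$ by $a_{i,j}=1$ if $\tau_j$ is the $i$-th element of $D$ in ascending order $<_b$, and $a_{i,j}=0$ otherwise. For $1\le i<j\le k$: if $\tau_i<_b\tau_j$, let $\gamma_{i,j}$ be the root on the row of $\tau_i$ such that $\gamma_{i,j}+\tau_j\in\Sigma^+$ (if $\tau_i$ is on row $m$ and $\tau_j$ on row $l$, then $\gamma_{i,j}=\alpha_{m,l-1}$); otherwise, i.e. if $\tau_j<_b\tau_i$, let $\nu_{i,j}$ be the root on the row of $\tau_j$ such that $\nu_{i,j}+\tau_i\in\Sigma^+$ (so $\nu_{i,j}=\alpha_{l,m-1}$). So for each $i<j$ exactly one of $\gamma_{i,j},\nu_{i,j}$ exists. Let $\Gamma_D$ be the set of all $\gamma_{i,j}$, $\Lambda_D$ the set of all $\nu_{i,j}$, $\Delta_D=\Gamma_D\cup\Lambda_D$, $R_D=\langle X_\gamma:\gamma\in\Gamma_D\rangle$ and $C_D=\langle X_\nu:\nu\in\Lambda_D\rangle$. *)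

theory Defs
  imports
    "HOL-Algebra.Generated_Groups"
    "HOL-Library.Poly_Mapping"
    "Jordan_Normal_Form.Matrix"
begin

text \<open>Roots live in the free abelian group on the simple roots, so that a sum of roots is the
  addition of that group.  All indices of roots, rows and columns are 1-based.\<close>

type_synonym rt = "nat \<Rightarrow>\<^sub>0 int"

definition simple_root :: "nat \<Rightarrow> rt" where
  "simple_root i = Poly_Mapping.single i 1"

definition rt_seg :: "nat \<Rightarrow> nat \<Rightarrow> rt" where
  "rt_seg i j = (\<Sum>t = i..j. simple_root t)"

definition pos_roots :: "nat \<Rightarrow> rt set" where
  "pos_roots n = {rt_seg i j | i j. 1 \<le> i \<and> i \<le> j \<and> j \<le> n - 1}"

definition rt_row :: "rt \<Rightarrow> nat" where
  "rt_row \<beta> = (THE i. \<exists>j. i \<le> j \<and> \<beta> = rt_seg i j)"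

definition rt_col :: "rt \<Rightarrow> nat" where
  "rt_col \<beta> = (THE c. \<exists>i j. i \<le> j \<and> \<beta> = rt_seg i j \<and> c = j + 1)"

definition closed_roots :: "nat \<Rightarrow> rt set \<Rightarrow> bool" where
  "closed_roots n S \<longleftrightarrow> S \<subseteq> pos_roots n \<and>
     (\<forall>\<alpha>\<in>S. \<forall>\<beta>\<in>S. \<alpha> + \<beta> \<in> pos_roots n \<longrightarrow> \<alpha> + \<beta> \<in> S)"

definition arm :: "rt \<Rightarrow> rt set" where
  "arm \<alpha> = {rt_seg i k | i j k. \<alpha> = rt_seg i j \<and> i \<le> k \<and> k < j}"

definition basic_set :: "nat \<Rightarrow> rt set \<Rightarrow> bool" where
  "basic_set n D \<longleftrightarrow> D \<noteq> {} \<and> D \<subseteq> pos_roots n \<and>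
     (\<forall>\<alpha>\<in>D. \<forall>\<beta>\<in>D. \<alpha> \<noteq> \<beta> \<longrightarrow> rt_row \<alpha> \<noteq> rt_row \<beta> \<and> rt_col \<alpha> \<noteq> rt_col \<beta>)"

definition GL :: "nat \<Rightarrow> 'a::field mat monoid" where
  "GL m = units_of (ring_mat TYPE('a) m ())"

definition unitri :: "nat \<Rightarrow> 'a::field mat set" where
  "unitri m = {A \<in> carrier_mat m m. upper_triangular A \<and> (\<forall>i<m. A $$ (i, i) = 1)}"

definition GL_restrict :: "nat \<Rightarrow> 'a::field mat set \<Rightarrow> 'a mat monoid" where
  "GL_restrict m H = (GL m)\<lparr>carrier := H\<rparr>"

definition conj_set :: "nat \<Rightarrow> 'a::field mat \<Rightarrow> 'a mat set \<Rightarrow> 'a mat set" where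
  "conj_set m w H = {w \<otimes>\<^bsub>GL m\<^esub> u \<otimes>\<^bsub>GL m\<^esub> inv\<^bsub>GL m\<^esub> w | u. u \<in> H}"

text \<open>Matrix entries are addressed from 0, whence the \<open>Suc\<close> for the 1-based matrix unit.\<close>

definition mat_unit :: "nat \<Rightarrow> nat \<Rightarrow> nat \<Rightarrow> 'a::field mat" where
  "mat_unit m r c = mat m m (\<lambda>(a, b). if Suc a = r \<and> Suc b = c then 1 else 0)"

definition root_subgroup :: "nat \<Rightarrow> rt \<Rightarrow> 'a::field mat set" where
  "root_subgroup n \<beta> = {1\<^sub>m n + c \<cdot>\<^sub>m mat_unit n (rt_row \<beta>) (rt_col \<beta>) | c. True}"

definition gen_by_roots :: "nat \<Rightarrow> rt set \<Rightarrow> 'a::field mat set" where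
  "gen_by_roots n S = generate (GL n) (\<Union>\<beta>\<in>S. root_subgroup n \<beta>)"

definition pattern_subgroup :: "nat \<Rightarrow> 'a::field mat set \<Rightarrow> bool" where
  "pattern_subgroup n H \<longleftrightarrow> (\<exists>S. closed_roots n S \<and> H = gen_by_roots n S)"

definition normalizes :: "nat \<Rightarrow> 'a::field mat set \<Rightarrow> 'a mat set \<Rightarrow> bool" where
  "normalizes m R V \<longleftrightarrow> (\<forall>g\<in>R. conj_set m g V = V)"

definition less_r :: "rt \<Rightarrow> rt \<Rightarrow> bool" where
  "less_r \<alpha> \<beta> \<longleftrightarrow> rt_col \<alpha> < rt_col \<beta>"

definition less_b :: "rt \<Rightarrow> rt \<Rightarrow> bool" where
  "less_b \<alpha> \<beta> \<longleftrightarrow> rt_row \<alpha> < rt_row \<beta>"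

text \<open>The \<open>i\<close>-th element (counted from 1) of \<open>D\<close> in ascending order.\<close>

definition nth_wrt :: "(rt \<Rightarrow> rt \<Rightarrow> bool) \<Rightarrow> rt set \<Rightarrow> nat \<Rightarrow> rt" where
  "nth_wrt lt D i = (THE \<tau>. \<tau> \<in> D \<and> Suc (card {\<sigma> \<in> D. lt \<sigma> \<tau>}) = i)"

definition tau :: "rt set \<Rightarrow> nat \<Rightarrow> rt" where
  "tau D i = nth_wrt less_r D i"

definition w_mat :: "rt set \<Rightarrow> 'a::field mat" where
  "w_mat D = mat (card D) (card D)
     (\<lambda>(a, b). if tau D (Suc b) = nth_wrt less_b D (Suc a) then 1 else 0)"

definition w0_mat :: "nat \<Rightarrow> 'a::field mat" where
  "w0_mat m = mat m m (\<lambda>(a, b). if a + b + 1 = m then 1 else 0)"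

text \<open>The partially defined families \<open>\<gamma>\<close> and \<open>\<nu>\<close> are given by a domain and a value;
  the value is meaningful on the domain only.\<close>

definition gamma_ex :: "rt set \<Rightarrow> nat \<Rightarrow> nat \<Rightarrow> bool" where
  "gamma_ex D i j \<longleftrightarrow> 1 \<le> i \<and> i < j \<and> j \<le> card D \<and> less_b (tau D i) (tau D j)"

definition gamma :: "nat \<Rightarrow> rt set \<Rightarrow> nat \<Rightarrow> nat \<Rightarrow> rt" where
  "gamma n D i j = (THE \<gamma>. \<gamma> \<in> pos_roots n \<and> rt_row \<gamma> = rt_row (tau D i) \<and>
     \<gamma> + tau D j \<in> pos_roots n)"

definition nu_ex :: "rt set \<Rightarrow> nat \<Rightarrow> nat \<Rightarrow> bool" where
  "nu_ex D i j \<longleftrightarrow> 1 \<le> i \<and> i < j \<and> j \<le> card D \<and> less_b (tau D j) (tau D i)"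

definition nu :: "nat \<Rightarrow> rt set \<Rightarrow> nat \<Rightarrow> nat \<Rightarrow> rt" where
  "nu n D i j = (THE \<nu>. \<nu> \<in> pos_roots n \<and> rt_row \<nu> = rt_row (tau D j) \<and>
     \<nu> + tau D i \<in> pos_roots n)"

definition Gamma_set :: "nat \<Rightarrow> rt set \<Rightarrow> rt set" where
  "Gamma_set n D = {gamma n D i j | i j. gamma_ex D i j}"

definition Lambda_set :: "nat \<Rightarrow> rt set \<Rightarrow> rt set" where
  "Lambda_set n D = {nu n D i j | i j. nu_ex D i j}"

definition Delta_set :: "nat \<Rightarrow> rt set \<Rightarrow> rt set" where
  "Delta_set n D = Gamma_set n D \<union> Lambda_set n D"

definition V_grp :: "nat \<Rightarrow> rt set \<Rightarrow> 'a::field mat set" where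
  "V_grp n D = gen_by_roots n (pos_roots n - (\<Union>\<alpha>\<in>D. arm \<alpha>))"

definition R_grp :: "nat \<Rightarrow> rt set \<Rightarrow> 'a::field mat set" where
  "R_grp n D = gen_by_roots n (Gamma_set n D)"

definition C_grp :: "nat \<Rightarrow> rt set \<Rightarrow> 'a::field mat set" where
  "C_grp n D = gen_by_roots n (Lambda_set n D)"

end

theory Submission
  imports Defs
begin

text \<open>A positive root is a matrix position \<open>(a, b)\<close> with \<open>a < b\<close>, and the sum of two roots is a
  root exactly when the positions compose.  So a closed set of roots is a strict order contained
  in \<open><\<close>, and the group generated by its root subgroups consists of all matrices with unit
  diagonal whose other nonzero entries lie in that order (\<open>gen_by_roots_image\<close>).  Every assertion
  thereby becomes one about orders.

  Let \<open>\<tau>\<^sub>i\<close> sit at position \<open>(r\<^sub>i, c\<^sub>i)\<close>, with \<open>c\<close> increasing.  Then \<open>\<gamma>\<^sub>i\<^sub>j\<close> is the position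
  \<open>(r\<^sub>i, r\<^sub>j)\<close> and \<open>\<nu>\<^sub>i\<^sub>j\<close> is \<open>(r\<^sub>j, r\<^sub>i)\<close>.  All of these have row and column index among the \<open>k\<close> rows
  of \<open>D\<close>, and striking out the other indices of a matrix is an isomorphism onto a group of
  \<open>k \<times> k\<close> matrices (\<open>pattern_mats_reindex_iso\<close>).  When the rows are sorted, by a permutation \<open>\<rho>\<close>,
  \<open>\<Delta>\<close> becomes the set of all pairs of ranks \<open>a < b\<close>, whence the full unitriangular group;
  \<open>\<Gamma>\<close> consists of the pairs on which the natural order agrees with its pullback along \<open>\<rho>\<close>, and
  \<open>\<Lambda>\<close> of those on which they disagree.  Conjugation by a permutation matrix pulls an order back
  (\<open>conj_set_perm_mat\<close>), so \<open>\<Gamma>\<close> gives \<open>U\<^sub>k \<inter> w U\<^sub>k w\<inverse>\<close>.  With \<open>w\<^sub>0 w\<close> in place of \<open>w\<close> one obtains the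
  converse of the order \<open>\<Lambda>\<close> read in reverse, and the isomorphism is inverse transposition
  (\<open>pattern_mats_converse_iso\<close>) followed by reversal of the indices.

  For the last part, composing a position outside all arms with one of \<open>\<Gamma>\<close>, on either side,
  stays outside all arms (\<open>off_arms_ideal\<close>).  Matrices supported outside the arms thus form an
  ideal under multiplication by \<open>R\<close>, which gives normality, and the product \<open>V R\<close> is the group
  of the union of the two orders (\<open>pattern_mats_normalizes\<close>, \<open>pattern_mats_set_mult\<close>).\<close>

section \<open>Pattern groups of strict orders\<close>

text \<open>For a strict order \<open>S\<close> on \<open>{..<m}\<close> these are the elements of its incidence algebra
  that have unit diagonal.  Abstract orders, rather than suborders of \<open><\<close>, make transposition
  available, which turns \<open>S\<close> into its converse.\<close>

definition pattern_mats :: "nat \<Rightarrow> (nat \<times> nat) set \<Rightarrow> 'a::field mat set" where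
  "pattern_mats m S = {A \<in> carrier_mat m m. (\<forall>i<m. A $$ (i, i) = 1) \<and>
     (\<forall>i<m. \<forall>j<m. i \<noteq> j \<longrightarrow> A $$ (i, j) \<noteq> 0 \<longrightarrow> (i, j) \<in> S)}"

definition pattern_space :: "nat \<Rightarrow> (nat \<times> nat) set \<Rightarrow> 'a::field mat set" where
  "pattern_space m S = {N \<in> carrier_mat m m. \<forall>i<m. \<forall>j<m. N $$ (i, j) \<noteq> 0 \<longrightarrow> (i, j) \<in> S}"

lemma pattern_matsI:
  assumes "A \<in> carrier_mat m m" "\<And>i. i < m \<Longrightarrow> A $$ (i, i) = 1"
    and "\<And>i j. i < m \<Longrightarrow> j < m \<Longrightarrow> i \<noteq> j \<Longrightarrow> A $$ (i, j) \<noteq> 0 \<Longrightarrow> (i, j) \<in> S"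
  shows "A \<in> pattern_mats m S"
  using assms unfolding pattern_mats_def by blast

lemma pattern_mats_carrier: "A \<in> pattern_mats m S \<Longrightarrow> A \<in> carrier_mat m m"
  by (simp add: pattern_mats_def)

lemma pattern_mats_diag: "A \<in> pattern_mats m S \<Longrightarrow> i < m \<Longrightarrow> A $$ (i, i) = 1"
  by (simp add: pattern_mats_def)

lemma pattern_mats_off_diag:
  "A \<in> pattern_mats m S \<Longrightarrow> i < m \<Longrightarrow> j < m \<Longrightarrow> i \<noteq> j \<Longrightarrow> A $$ (i, j) \<noteq> 0 \<Longrightarrow> (i, j) \<in> S"
  by (simp add: pattern_mats_def)

lemma pattern_spaceI:
  assumes "A \<in> carrier_mat m m" "\<And>i j. i < m \<Longrightarrow> j < m \<Longrightarrow> A $$ (i, j) \<noteq> 0 \<Longrightarrow> (i, j) \<in> S"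
  shows "A \<in> pattern_space m S"
  using assms unfolding pattern_space_def by blast

lemma pattern_space_carrier: "A \<in> pattern_space m S \<Longrightarrow> A \<in> carrier_mat m m"
  by (simp add: pattern_space_def)

lemma pattern_space_entry:
  "A \<in> pattern_space m S \<Longrightarrow> i < m \<Longrightarrow> j < m \<Longrightarrow> A $$ (i, j) \<noteq> 0 \<Longrightarrow> (i, j) \<in> S"
  by (simp add: pattern_space_def)

abbreviation upper :: "nat \<Rightarrow> (nat \<times> nat) set" where
  "upper m \<equiv> {(a, b). a < b \<and> b < m}"

lemma upper_irrefl: "S \<subseteq> upper m \<Longrightarrow> irrefl S"
  by (auto simp: irrefl_def)

lemma unitri_eq_pattern_mats: "unitri k = pattern_mats k (upper k)"
proof (intro equalityI subsetI)
  fix A :: "'a mat" assume A: "A \<in> unitri k"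
  have "(i, j) \<in> upper k" if "i < k" "j < k" "i \<noteq> j" "A $$ (i, j) \<noteq> 0" for i j
  proof -
    have "\<not> j < i" using A that by (auto simp: unitri_def upper_triangular_def)
    then show ?thesis using that by auto
  qed
  then show "A \<in> pattern_mats k (upper k)"
    using A by (intro pattern_matsI) (auto simp: unitri_def)
next
  fix A :: "'a mat" assume A: "A \<in> pattern_mats k (upper k)"
  have "A $$ (i, j) = 0" if "i < k" "j < i" for i j
  proof (rule ccontr)
    assume "A $$ (i, j) \<noteq> 0"
    then have "(i, j) \<in> upper k" using pattern_mats_off_diag[OF A] that by auto
    then show False using that by auto
  qed
  then show "A \<in> unitri k"
    using pattern_mats_carrier[OF A] pattern_mats_diag[OF A]
    by (auto simp: unitri_def upper_triangular_def)
qed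

lemma pattern_mats_Int: "pattern_mats m S \<inter> pattern_mats m T = pattern_mats m (S \<inter> T)"
proof (intro equalityI subsetI)
  fix A :: "'a mat" assume A: "A \<in> pattern_mats m S \<inter> pattern_mats m T"
  then have "A \<in> pattern_mats m S" "A \<in> pattern_mats m T" by simp_all
  then show "A \<in> pattern_mats m (S \<inter> T)"
    using pattern_mats_carrier pattern_mats_diag pattern_mats_off_diag
    by (intro pattern_matsI IntI) blast+
qed (auto intro!: pattern_matsI dest: pattern_mats_carrier pattern_mats_diag pattern_mats_off_diag)

lemma pattern_mats_mono: "S \<subseteq> T \<Longrightarrow> pattern_mats m S \<subseteq> pattern_mats m T"
  by (auto intro!: pattern_matsI dest: pattern_mats_carrier pattern_mats_diag pattern_mats_off_diag)

lemma mat_mult_entry: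
  assumes "A \<in> carrier_mat l m" "B \<in> carrier_mat m n" "i < l" "j < n"
  shows "(A * B) $$ (i, j) = (\<Sum>x<m. A $$ (i, x) * B $$ (x, j))"
  using assms by (auto simp: scalar_prod_def lessThan_atLeast0 intro!: sum.cong)

lemma pattern_space_mult_left:
  assumes g: "g \<in> pattern_mats m T" and N: "N \<in> pattern_space m S" and TS: "T O S \<subseteq> S"
  shows "g * N \<in> pattern_space m S"
proof -
  have gc: "g \<in> carrier_mat m m" and Nc: "N \<in> carrier_mat m m"
    using g N by (auto dest: pattern_mats_carrier pattern_space_carrier)
  have "(i, j) \<in> S" if ij: "i < m" "j < m" and nz: "(g * N) $$ (i, j) \<noteq> 0" for i j
  proof -
    obtain x where x: "x < m" "g $$ (i, x) * N $$ (x, j) \<noteq> 0"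
      using nz unfolding mat_mult_entry[OF gc Nc ij] by (meson lessThan_iff sum.neutral)
    then have "(x, j) \<in> S" using pattern_space_entry[OF N] ij by auto
    moreover have "i = x \<or> (i, x) \<in> T" using pattern_mats_off_diag[OF g] x ij by auto
    ultimately show ?thesis using TS by auto
  qed
  then show ?thesis using gc Nc by (intro pattern_spaceI) auto
qed

lemma pattern_space_mult_right:
  assumes g: "g \<in> pattern_mats m T" and N: "N \<in> pattern_space m S" and ST: "S O T \<subseteq> S"
  shows "N * g \<in> pattern_space m S"
proof -
  have gc: "g \<in> carrier_mat m m" and Nc: "N \<in> carrier_mat m m"
    using g N by (auto dest: pattern_mats_carrier pattern_space_carrier)
  have "(i, j) \<in> S" if ij: "i < m" "j < m" and nz: "(N * g) $$ (i, j) \<noteq> 0" for i j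
  proof -
    obtain x where x: "x < m" "N $$ (i, x) * g $$ (x, j) \<noteq> 0"
      using nz unfolding mat_mult_entry[OF Nc gc ij] by (meson lessThan_iff sum.neutral)
    then have "(i, x) \<in> S" using pattern_space_entry[OF N] ij by auto
    moreover have "x = j \<or> (x, j) \<in> T" using pattern_mats_off_diag[OF g] x ij by auto
    ultimately show ?thesis using ST by auto
  qed
  then show ?thesis using gc Nc by (intro pattern_spaceI) auto
qed

lemma one_in_pattern_mats: "1\<^sub>m m \<in> pattern_mats m S"
  by (rule pattern_matsI) auto

lemma pattern_mats_add_space:
  assumes "A \<in> pattern_mats m S" "N \<in> pattern_space m S" "irrefl S"
  shows "A + N \<in> pattern_mats m S"
proof (rule pattern_matsI)
  note c = pattern_mats_carrier[OF assms(1)] pattern_space_carrier[OF assms(2)]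
  show "A + N \<in> carrier_mat m m" using c by simp
  show "(A + N) $$ (i, i) = 1" if "i < m" for i
    using c that pattern_mats_diag[OF assms(1) that] pattern_space_entry[OF assms(2) that that] assms(3)
    by (auto simp: irrefl_def)
  show "(i, j) \<in> S" if "i < m" "j < m" "i \<noteq> j" "(A + N) $$ (i, j) \<noteq> 0" for i j
    using c that pattern_mats_off_diag[OF assms(1) that(1-3)] pattern_space_entry[OF assms(2) that(1,2)]
    by (cases "A $$ (i, j) = 0") auto
qed

lemma pattern_mats_decompose:
  assumes A: "A \<in> pattern_mats m S"
  obtains N where "N \<in> pattern_space m S" "A = 1\<^sub>m m + N"
proof
  have Ac: "A \<in> carrier_mat m m" using A by (rule pattern_mats_carrier)
  show "A = 1\<^sub>m m + (A - 1\<^sub>m m)" using Ac by (intro eq_matI) auto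
  have "(i, j) \<in> S" if "i < m" "j < m" "(A - 1\<^sub>m m) $$ (i, j) \<noteq> 0" for i j
    using Ac that pattern_mats_diag[OF A] pattern_mats_off_diag[OF A that(1,2)] by (cases "i = j") auto
  then show "A - 1\<^sub>m m \<in> pattern_space m S" by (intro pattern_spaceI) auto
qed

lemma pattern_mats_mult:
  assumes A: "A \<in> pattern_mats m S" and B: "B \<in> pattern_mats m S" and S: "trans S" "irrefl S"
  shows "A * B \<in> pattern_mats m S"
proof -
  obtain N where N: "N \<in> pattern_space m S" "B = 1\<^sub>m m + N" using pattern_mats_decompose[OF B] .
  have c: "A \<in> carrier_mat m m" "N \<in> carrier_mat m m"
    using A N by (auto dest: pattern_mats_carrier pattern_space_carrier)
  have "A * B = A + A * N"
    using c unfolding N by (simp add: mult_add_distrib_mat[OF c(1) one_carrier_mat c(2)])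
  moreover have "A * N \<in> pattern_space m S"
    using pattern_space_mult_left[OF A N(1)] S(1) by (simp add: trans_O_subset)
  ultimately show ?thesis using pattern_mats_add_space[OF A _ S(2)] by simp
qed

section \<open>Generation by elementary matrices\<close>

lemma GL_group: "group (GL m :: 'a::field mat monoid)"
  unfolding GL_def by (rule monoid.units_group[OF ring.is_monoid[OF ring_mat]])

lemma GL_mult [simp]: "A \<otimes>\<^bsub>GL m\<^esub> B = A * B"
  by (simp add: GL_def units_of_def ring_mat_def)

lemma GL_one [simp]: "\<one>\<^bsub>GL m\<^esub> = 1\<^sub>m m"
  by (simp add: GL_def units_of_def ring_mat_def)

lemma GL_carrier_iff:
  "A \<in> carrier (GL m) \<longleftrightarrow> A \<in> carrier_mat m m \<and> (\<exists>B \<in> carrier_mat m m. B * A = 1\<^sub>m m \<and> A * B = 1\<^sub>m m)"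
  by (auto simp: GL_def units_of_def Units_def ring_mat_def)

lemma GL_inv_equality:
  fixes A B :: "'a::field mat"
  assumes "A \<in> carrier_mat m m" "B \<in> carrier_mat m m" "A * B = 1\<^sub>m m" "B * A = 1\<^sub>m m"
  shows "inv\<^bsub>GL m\<^esub> A = B"
  using group.inv_equality[OF GL_group, of m B A] assms by (auto simp: GL_carrier_iff)

abbreviation elem_mat :: "nat \<Rightarrow> nat \<Rightarrow> nat \<Rightarrow> 'a \<Rightarrow> 'a::field mat" where
  "elem_mat m i j c \<equiv> 1\<^sub>m m + c \<cdot>\<^sub>m mat_unit m (Suc i) (Suc j)"

lemma elem_mat_carrier [simp]: "elem_mat m i j c \<in> carrier_mat m m"
  by (simp add: mat_unit_def)

lemma elem_mat_entry:
  "x < m \<Longrightarrow> y < m \<Longrightarrow>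
    elem_mat m i j c $$ (x, y) = (if x = y then 1 else 0) + (if x = i \<and> y = j then c else 0)"
  by (simp add: mat_unit_def)

lemma mult_elem_mat_entry:
  assumes A: "A \<in> carrier_mat m m" and xy: "x < m" "y < m" and i: "i < m"
  shows "(A * elem_mat m i j c) $$ (x, y) = A $$ (x, y) + (if y = j then A $$ (x, i) * c else 0)"
proof -
  have "(A * elem_mat m i j c) $$ (x, y)
      = (\<Sum>t<m. (if t = y then A $$ (x, t) else 0) + (if t = i then if y = j then A $$ (x, t) * c else 0 else 0))"
    using xy by (subst mat_mult_entry[OF A elem_mat_carrier]) (auto simp: elem_mat_entry algebra_simps intro!: sum.cong)
  also have "\<dots> = A $$ (x, y) + (if y = j then A $$ (x, i) * c else 0)"
    using xy i by (simp add: sum.distrib)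
  finally show ?thesis .
qed

lemma elem_mat_mult_elem_mat:
  assumes "i < m" "i \<noteq> j"
  shows "elem_mat m i j c * elem_mat m i j d = elem_mat m i j (c + d)"
proof (rule eq_matI)
  fix x y assume "x < dim_row (elem_mat m i j (c + d))" "y < dim_col (elem_mat m i j (c + d))"
  then have xy: "x < m" "y < m" by (simp_all add: mat_unit_def)
  show "(elem_mat m i j c * elem_mat m i j d) $$ (x, y) = elem_mat m i j (c + d) $$ (x, y)"
    unfolding mult_elem_mat_entry[OF elem_mat_carrier xy assms(1)]
    using xy assms by (auto simp: elem_mat_entry simp del: index_add_mat index_smult_mat)
qed (auto simp: mat_unit_def)

lemma elem_mat_zero: "elem_mat m i j 0 = 1\<^sub>m m"
  by (intro eq_matI) (auto simp: mat_unit_def)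

lemma elem_mat_GL:
  assumes "i < m" "i \<noteq> j"
  shows "elem_mat m i j c \<in> carrier (GL m)" "inv\<^bsub>GL m\<^esub> (elem_mat m i j c) = elem_mat m i j (- c)"
proof -
  have *: "elem_mat m i j c * elem_mat m i j (- c) = 1\<^sub>m m"
    "elem_mat m i j (- c) * elem_mat m i j c = 1\<^sub>m m"
    unfolding elem_mat_mult_elem_mat[OF assms] by (simp_all add: elem_mat_zero)
  show "elem_mat m i j c \<in> carrier (GL m)"
    unfolding GL_carrier_iff using * elem_mat_carrier by blast
  show "inv\<^bsub>GL m\<^esub> (elem_mat m i j c) = elem_mat m i j (- c)"
    using GL_inv_equality[OF elem_mat_carrier elem_mat_carrier *] .
qed

lemma elem_mat_in_pattern_mats:
  assumes "(i, j) \<in> S" "i \<noteq> j"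
  shows "elem_mat m i j c \<in> pattern_mats m S"
  using assms
  by (intro pattern_matsI elem_mat_carrier)
    (auto simp: elem_mat_entry simp del: index_add_mat index_smult_mat split: if_splits)

lemma strict_order_minimal:
  assumes S: "trans S" "irrefl S" and X: "finite X" "X \<noteq> {}"
  obtains a where "a \<in> X" "\<And>x. x \<in> X \<Longrightarrow> (x, a) \<notin> S"
proof -
  let ?R = "S \<inter> X \<times> X"
  have t: "trans ?R" using S(1) unfolding trans_def by blast
  have "acyclic ?R"
    unfolding acyclic_def trancl_id[OF t] using S(2) by (auto simp: irrefl_def)
  then have "wf ?R" using X(1) by (intro finite_acyclic_wf) auto
  moreover obtain x where "x \<in> X" using X(2) by blast
  ultimately obtain a where a: "a \<in> X" "\<And>y. (y, a) \<in> ?R \<Longrightarrow> y \<notin> X"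
    by (rule wfE_min) blast
  have "(x, a) \<notin> S" if "x \<in> X" for x using a that by blast
  then show thesis using a(1) that by blast
qed

text \<open>Off-diagonal entries are peeled off one at a time.  If \<open>a\<close> is minimal among the rows with a
  nonzero off-diagonal entry, then column \<open>a\<close> of \<open>A\<close> is the unit column, because an entry at
  \<open>(x, a)\<close> would make \<open>x\<close> a smaller such row.  Hence multiplying on the right by an elementary
  matrix at \<open>(a, b)\<close> changes nothing but the entry \<open>(a, b)\<close>.\<close>

lemma pattern_mats_subset_generate:
  assumes S: "trans S" "irrefl S" and A: "A \<in> pattern_mats m S"
  shows "A \<in> generate (GL m) {elem_mat m i j c | i j c. (i, j) \<in> S}" (is "_ \<in> generate _ ?E")
  using A
proof (induction "card {(i, j). i < m \<and> j < m \<and> i \<noteq> j \<and> A $$ (i, j) \<noteq> 0}" arbitrary: A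
    rule: less_induct)
  case less
  let ?Z = "\<lambda>A :: 'a mat. {(i, j). i < m \<and> j < m \<and> i \<noteq> j \<and> A $$ (i, j) \<noteq> 0}"
  have fin: "finite (?Z B)" for B :: "'a mat"
    by (rule finite_subset[of _ "{..<m} \<times> {..<m}"]) auto
  have Ac: "A \<in> carrier_mat m m" and Ad: "\<And>i. i < m \<Longrightarrow> A $$ (i, i) = 1"
    using pattern_mats_carrier pattern_mats_diag less.prems by blast+
  note off = pattern_mats_off_diag[OF less.prems]
  show ?case
  proof (cases "?Z A = {}")
    case True
    have "A $$ (i, j) = 1\<^sub>m m $$ (i, j)" if "i < m" "j < m" for i j
      using True Ad that by (cases "i = j") auto
    then have "A = 1\<^sub>m m" using Ac by (intro eq_matI) auto
    then show ?thesis using generate.one[of "GL m" ?E] by simp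
  next
    case False
    have X: "finite (fst ` ?Z A)" "fst ` ?Z A \<noteq> {}" using fin False by auto
    obtain a where a: "a \<in> fst ` ?Z A" and amin: "\<And>x. x \<in> fst ` ?Z A \<Longrightarrow> (x, a) \<notin> S"
      by (rule strict_order_minimal[OF S X]) blast
    from a obtain b where b: "a < m" "b < m" "a \<noteq> b" "A $$ (a, b) \<noteq> 0" by auto
    have abS: "(a, b) \<in> S" using off b by blast
    have col: "A $$ (x, a) = 0" if "x < m" "x \<noteq> a" for x
    proof (rule ccontr)
      assume nz: "A $$ (x, a) \<noteq> 0"
      then have "(x, a) \<in> S" using off that b by blast
      moreover have "(x, a) \<in> ?Z A" using nz that b by auto
      ultimately show False using amin[of x] by force
    qed
    define B where "B = mat m m (\<lambda>(i, j). if i = a \<and> j = b then 0 else A $$ (i, j))"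
    have Bc: "B \<in> carrier_mat m m" by (simp add: B_def)
    have Be: "B $$ (i, j) = (if i = a \<and> j = b then 0 else A $$ (i, j))" if "i < m" "j < m" for i j
      using that by (simp add: B_def)
    have "?Z B \<subseteq> ?Z A - {(a, b)}"
    proof
      fix p assume "p \<in> ?Z B"
      then obtain i j where "p = (i, j)" "i < m" "j < m" "i \<noteq> j" "B $$ (i, j) \<noteq> 0" by blast
      then show "p \<in> ?Z A - {(a, b)}" by (cases "i = a \<and> j = b") (simp_all add: Be)
    qed
    moreover have "(a, b) \<in> ?Z A" using b by simp
    ultimately have "?Z B \<subset> ?Z A" by blast
    then have "card (?Z B) < card (?Z A)" by (rule psubset_card_mono[OF fin])
    moreover have "B \<in> pattern_mats m S"
      using off b Ad by (intro pattern_matsI Bc) (auto simp: Be split: if_splits)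
    ultimately have Bg: "B \<in> generate (GL m) ?E" using less.hyps by simp
    have "A = B * elem_mat m a b (A $$ (a, b))"
    proof (rule eq_matI)
      fix x y assume "x < dim_row (B * elem_mat m a b (A $$ (a, b)))"
        "y < dim_col (B * elem_mat m a b (A $$ (a, b)))"
      then have xy: "x < m" "y < m" by (simp_all add: mat_unit_def B_def)
      show "A $$ (x, y) = (B * elem_mat m a b (A $$ (a, b))) $$ (x, y)"
        unfolding mult_elem_mat_entry[OF Bc xy b(1)] using xy b col[of x] Ad by (auto simp: Be)
    qed (use Ac in \<open>auto simp: mat_unit_def B_def\<close>)
    moreover have "elem_mat m a b (A $$ (a, b)) \<in> generate (GL m) ?E"
      using abS by (intro generate.incl) blast
    ultimately show ?thesis using generate.eng[OF Bg, of "elem_mat m a b (A $$ (a, b))"] by simp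
  qed
qed

text \<open>Inverses of arbitrary matrices never have to be computed: the generated group only inverts
  elementary matrices, and the inverse of one is elementary at the same position.\<close>

lemma pattern_mats_eq_generate:
  assumes S: "trans S" "irrefl S" "S \<subseteq> {..<m} \<times> {..<m}"
  shows "pattern_mats m S = generate (GL m) {elem_mat m i j c | i j c. (i, j) \<in> S}"
    (is "_ = generate _ ?E")
proof (intro equalityI subsetI)
  fix A :: "'a mat" assume "A \<in> generate (GL m) ?E"
  then show "A \<in> pattern_mats m S"
  proof induction
    case one
    then show ?case by (simp add: one_in_pattern_mats)
  next
    case (incl h)
    then show ?case using S elem_mat_in_pattern_mats by (fastforce simp: irrefl_def)
  next
    case (inv h)
    then obtain i j c where h: "h = elem_mat m i j c" "(i, j) \<in> S" by blast
    then have ij: "i < m" "i \<noteq> j" using S by (auto simp: irrefl_def)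
    then show ?case unfolding h(1) elem_mat_GL(2)[OF ij]
      using elem_mat_in_pattern_mats[OF h(2)] by blast
  next
    case (eng h1 h2)
    then show ?case using pattern_mats_mult S by simp
  qed
qed (rule pattern_mats_subset_generate[OF S(1,2)])

lemma pattern_mats_subgroup:
  assumes S: "trans S" "irrefl S" "S \<subseteq> {..<m} \<times> {..<m}"
  shows "subgroup (pattern_mats m S) (GL m)"
proof -
  have "elem_mat m i j c \<in> carrier (GL m)" if "(i, j) \<in> S" for i j and c :: 'a
    using that S by (intro elem_mat_GL) (auto simp: irrefl_def)
  then show ?thesis unfolding pattern_mats_eq_generate[OF S]
    by (intro group.generate_is_subgroup[OF GL_group]) auto
qed

section \<open>Isomorphisms between pattern groups\<close>

text \<open>Passing to the submatrix on rows and columns \<open>f 0, f 1, \<dots>\<close> is multiplicative because an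
  entry \<open>(f i, x)\<close> of a matrix of the larger group vanishes unless \<open>x\<close> is again a value of \<open>f\<close>.\<close>

lemma pattern_mats_reindex_iso:
  fixes f :: "nat \<Rightarrow> nat"
  assumes inj: "inj_on f {..<k}" and f: "f ` {..<k} \<subseteq> {..<n}" and S: "S \<subseteq> {..<k} \<times> {..<k}"
  shows "GL_restrict n (pattern_mats n (map_prod f f ` S) :: 'a::field mat set)
    \<cong> GL_restrict k (pattern_mats k S :: 'a mat set)"
proof -
  let ?P = "pattern_mats n (map_prod f f ` S) :: 'a mat set"
  let ?r = "\<lambda>A :: 'a mat. mat k k (\<lambda>(i, j). A $$ (f i, f j))"
  have fn: "f i < n" if "i < k" for i using f that by auto
  have finj: "f i = f j \<longleftrightarrow> i = j" if "i < k" "j < k" for i j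
    using inj_on_eq_iff[OF inj] that by simp
  have fS: "(i, j) \<in> S" if "(f i, f j) \<in> map_prod f f ` S" "i < k" "j < k" for i j
  proof -
    from that(1) obtain p where p: "(f i, f j) = map_prod f f p" "p \<in> S" by (rule imageE)
    obtain a b where ab: "p = (a, b)" by (cases p)
    then have "a < k" "b < k" using p(2) S by auto
    then have "i = a" "j = b" using p(1) that(2,3) by (simp_all add: ab finj)
    then show ?thesis using p(2) ab by simp
  qed
  have range: "?r A \<in> pattern_mats k S" if A: "A \<in> ?P" for A
  proof (rule pattern_matsI)
    show "?r A $$ (i, i) = 1" if "i < k" for i
      using pattern_mats_diag[OF A fn[OF that]] that by simp
    show "(i, j) \<in> S" if "i < k" "j < k" "i \<noteq> j" "?r A $$ (i, j) \<noteq> 0" for i j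
      using pattern_mats_off_diag[OF A fn fn, of i j] that finj by (intro fS) auto
  qed simp
  have hom: "?r (A * B) = ?r A * ?r B" if A: "A \<in> ?P" and B: "B \<in> ?P" for A B
  proof (rule eq_matI)
    fix i j assume "i < dim_row (?r A * ?r B)" "j < dim_col (?r A * ?r B)"
    then have ij: "i < k" "j < k" by simp_all
    have Ac: "A \<in> carrier_mat n n" and Bc: "B \<in> carrier_mat n n"
      using A B by (simp_all add: pattern_mats_carrier)
    have "?r (A * B) $$ (i, j) = (\<Sum>x<n. A $$ (f i, x) * B $$ (x, f j))"
      using ij fn by (simp add: mat_mult_entry[OF Ac Bc])
    also have "\<dots> = (\<Sum>x\<in>f ` {..<k}. A $$ (f i, x) * B $$ (x, f j))"
    proof (rule sum.mono_neutral_right)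
      show "\<forall>x\<in>{..<n} - f ` {..<k}. A $$ (f i, x) * B $$ (x, f j) = 0"
      proof
        fix x assume x: "x \<in> {..<n} - f ` {..<k}"
        have "(f i, x) \<notin> map_prod f f ` S" using x S by auto
        moreover have "f i \<noteq> x" using x ij by auto
        ultimately have "A $$ (f i, x) = 0" using pattern_mats_off_diag[OF A, of "f i" x] x ij fn by auto
        then show "A $$ (f i, x) * B $$ (x, f j) = 0" by simp
      qed
    qed (use f in auto)
    also have "\<dots> = (\<Sum>x<k. A $$ (f i, f x) * B $$ (f x, f j))"
      by (simp add: sum.reindex[OF inj])
    also have "\<dots> = (?r A * ?r B) $$ (i, j)"
      using ij by (subst mat_mult_entry[of _ k k _ k]) auto
    finally show "?r (A * B) $$ (i, j) = (?r A * ?r B) $$ (i, j)" .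
  qed simp_all
  have inj_r: "inj_on ?r ?P"
  proof (rule inj_onI)
    fix A B assume A: "A \<in> ?P" and B: "B \<in> ?P" and eq: "?r A = ?r B"
    have "A $$ (x, y) = B $$ (x, y)" if xy: "x < n" "y < n" for x y
    proof (cases "x = y \<or> (x, y) \<notin> map_prod f f ` S")
      case True
      then show ?thesis
        using pattern_mats_diag[OF A] pattern_mats_diag[OF B]
          pattern_mats_off_diag[OF A xy] pattern_mats_off_diag[OF B xy] xy by metis
    next
      case False
      then obtain i j where "x = f i" "y = f j" "i < k" "j < k" using S by auto
      then show ?thesis using arg_cong[OF eq, of "\<lambda>M. M $$ (i, j)"] by simp
    qed
    then show "A = B" using pattern_mats_carrier[OF A] pattern_mats_carrier[OF B] by (intro eq_matI) auto
  qed
  have surj: "C \<in> ?r ` ?P" if C: "C \<in> pattern_mats k S" for C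
  proof
    let ?g = "inv_into {..<k} f"
    let ?A = "mat n n (\<lambda>(x, y). if x = y then 1 else if (x, y) \<in> map_prod f f ` S
      then C $$ (?g x, ?g y) else 0)"
    show "?A \<in> ?P" by (intro pattern_matsI) (auto split: if_splits)
    show "C = ?r ?A"
    proof (rule eq_matI)
      fix i j assume "i < dim_row (?r ?A)" "j < dim_col (?r ?A)"
      then have ij: "i < k" "j < k" by simp_all
      have inS: "(f i, f j) \<in> map_prod f f ` S \<longleftrightarrow> (i, j) \<in> S"
        by (rule iffI[OF fS[OF _ ij] map_prod_imageI])
      have "?A $$ (f i, f j) = (if i = j then 1 else if (i, j) \<in> S then C $$ (i, j) else 0)"
        using fn[OF ij(1)] fn[OF ij(2)] ij by (simp add: inS finj inv_into_f_f[OF inj])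
      also have "\<dots> = C $$ (i, j)" 
        using pattern_mats_diag[OF C] pattern_mats_off_diag[OF C ij] ij by auto
      finally show "C $$ (i, j) = ?r ?A $$ (i, j)" using ij by simp
    qed (use pattern_mats_carrier[OF C] in auto)
  qed
  have "?r \<in> iso (GL_restrict n ?P) (GL_restrict k (pattern_mats k S))"
    using range hom inj_r surj by (auto simp: iso_def hom_def GL_restrict_def bij_betw_def)
  then show ?thesis by (rule is_isoI)
qed

text \<open>Transposition reverses products and so does inversion; their composite is an isomorphism.\<close>

lemma pattern_mats_converse_iso:
  assumes S: "trans S" "irrefl S" "S \<subseteq> {..<m} \<times> {..<m}"
  shows "GL_restrict m (pattern_mats m S :: 'a::field mat set)
    \<cong> GL_restrict m (pattern_mats m (S\<inverse>) :: 'a mat set)"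
proof -
  interpret G: group "GL m :: 'a mat monoid" by (rule GL_group)
  let ?P = "pattern_mats m S :: 'a mat set"
  let ?h = "\<lambda>A :: 'a mat. transpose_mat (inv\<^bsub>GL m\<^esub> A)"
  interpret P: subgroup ?P "GL m" by (rule pattern_mats_subgroup[OF S])
  have tr: "transpose_mat A \<in> pattern_mats m (T\<inverse>)" if A: "A \<in> pattern_mats m T" for A :: "'a mat" and T
  proof (rule pattern_matsI)
    note Ac = pattern_mats_carrier[OF A]
    show "transpose_mat A \<in> carrier_mat m m" using Ac by simp
    show "transpose_mat A $$ (i, i) = 1" if "i < m" for i
      using Ac pattern_mats_diag[OF A that] that by simp
    show "(i, j) \<in> T\<inverse>" if "i < m" "j < m" "i \<noteq> j" "transpose_mat A $$ (i, j) \<noteq> 0" for i j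
      using Ac pattern_mats_off_diag[OF A, of j i] that by auto
  qed
  have hom: "?h (A * B) = ?h A * ?h B" if "A \<in> ?P" "B \<in> ?P" for A B
  proof -
    have "inv\<^bsub>GL m\<^esub> (A * B) = inv\<^bsub>GL m\<^esub> B * inv\<^bsub>GL m\<^esub> A"
      using G.inv_mult_group[OF P.mem_carrier P.mem_carrier, of A B] that by simp
    moreover have "inv\<^bsub>GL m\<^esub> A \<in> carrier_mat m m" "inv\<^bsub>GL m\<^esub> B \<in> carrier_mat m m"
      using that P.m_inv_closed pattern_mats_carrier by blast+
    ultimately show ?thesis by (simp add: transpose_mult)
  qed
  have "bij_betw ?h ?P (pattern_mats m (S\<inverse>))"
  proof (rule bij_betw_byWitness[where f' = "\<lambda>A. inv\<^bsub>GL m\<^esub> (transpose_mat A)"])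
    show "?h ` ?P \<subseteq> pattern_mats m (S\<inverse>)" using tr P.m_inv_closed by blast
    have untr: "transpose_mat A \<in> ?P" if "A \<in> pattern_mats m (S\<inverse>)" for A
      using tr[OF that] by simp
    then show "(\<lambda>A. inv\<^bsub>GL m\<^esub> (transpose_mat A)) ` pattern_mats m (S\<inverse>) \<subseteq> ?P"
      using P.m_inv_closed by blast
    show "\<forall>A\<in>pattern_mats m (S\<inverse>). ?h (inv\<^bsub>GL m\<^esub> (transpose_mat A)) = A"
      using untr P.mem_carrier by auto
  qed (use P.mem_carrier in auto)
  then have "?h \<in> iso (GL_restrict m ?P) (GL_restrict m (pattern_mats m (S\<inverse>)))"
    using hom tr P.m_inv_closed by (auto simp: iso_def hom_def GL_restrict_def)
  then show ?thesis by (rule is_isoI)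
qed

definition perm_mat :: "nat \<Rightarrow> (nat \<Rightarrow> nat) \<Rightarrow> 'a::field mat" where
  "perm_mat m \<rho> = mat m m (\<lambda>(a, b). if b = \<rho> a then 1 else 0)"

lemma perm_mat_carrier [simp]: "perm_mat m \<rho> \<in> carrier_mat m m"
  by (simp add: perm_mat_def)

lemma perm_mat_mult_entry:
  assumes "A \<in> carrier_mat m m" "a < m" "b < m" "\<rho> a < m"
  shows "(perm_mat m \<rho> * A) $$ (a, b) = A $$ (\<rho> a, b)"
  using assms by (subst mat_mult_entry[of _ m m _ m]) (simp_all add: perm_mat_def if_distrib if_distribR cong: if_cong)

lemma mult_perm_mat_transpose_entry:
  assumes "A \<in> carrier_mat m m" "a < m" "b < m" "\<rho> b < m"
  shows "(A * transpose_mat (perm_mat m \<rho>)) $$ (a, b) = A $$ (a, \<rho> b)"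
  using assms by (subst mat_mult_entry[of _ m m _ m]) (simp_all add: perm_mat_def if_distrib if_distribR cong: if_cong)

lemma perm_mat_mult:
  assumes "bij_betw \<sigma> {..<m} {..<m}"
  shows "perm_mat m \<sigma> * perm_mat m \<rho> = perm_mat m (\<rho> \<circ> \<sigma>)"
proof (rule eq_matI)
  fix a b assume "a < dim_row (perm_mat m (\<rho> \<circ> \<sigma>))" "b < dim_col (perm_mat m (\<rho> \<circ> \<sigma>))"
  then have ab: "a < m" "b < m" by (simp_all add: perm_mat_def)
  then have s: "\<sigma> a < m" using assms by (auto simp: bij_betw_def)
  show "(perm_mat m \<sigma> * perm_mat m \<rho>) $$ (a, b) = perm_mat m (\<rho> \<circ> \<sigma>) $$ (a, b)"
    using perm_mat_mult_entry[of "perm_mat m \<rho>" m a b \<sigma>] ab s by (simp add: perm_mat_def)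
qed (simp_all add: perm_mat_def)

lemma perm_mat_inv:
  assumes "bij_betw \<rho> {..<m} {..<m}"
  shows "inv\<^bsub>GL m\<^esub> (perm_mat m \<rho>) = transpose_mat (perm_mat m \<rho> :: 'a::field mat)"
proof -
  let ?w = "perm_mat m \<rho> :: 'a mat"
  have r: "\<rho> a < m" if "a < m" for a using assms that by (auto simp: bij_betw_def)
  have eq: "\<rho> a = \<rho> b \<longleftrightarrow> a = b" if "a < m" "b < m" for a b
    using assms that by (auto simp: bij_betw_def inj_on_def)
  have 1: "?w * transpose_mat ?w = 1\<^sub>m m"
  proof (rule eq_matI)
    fix a b assume "a < dim_row (1\<^sub>m m :: 'a mat)" "b < dim_col (1\<^sub>m m :: 'a mat)"
    then have ab: "a < m" "b < m" by simp_all
    then show "(?w * transpose_mat ?w) $$ (a, b) = 1\<^sub>m m $$ (a, b)"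
      using r eq by (subst mult_perm_mat_transpose_entry) (auto simp: perm_mat_def)
  qed (simp_all add: perm_mat_def)
  let ?i = "inv_into {..<m} \<rho>"
  have i: "?i a < m" "\<rho> (?i a) = a" if "a < m" for a
    using assms that by (auto simp: bij_betw_def f_inv_into_f intro!: inv_into_into[of _ \<rho> "{..<m}", simplified])
  have ir: "?i (\<rho> a) = a" if "a < m" for a using bij_betw_inv_into_left[OF assms] that by simp
  have 2: "transpose_mat ?w * ?w = 1\<^sub>m m"
  proof (rule eq_matI)
    fix a b assume "a < dim_row (1\<^sub>m m :: 'a mat)" "b < dim_col (1\<^sub>m m :: 'a mat)"
    then have ab: "a < m" "b < m" by simp_all
    have "(transpose_mat ?w * ?w) $$ (a, b)
        = (\<Sum>x<m. (if a = \<rho> x then 1 else 0) * (if b = \<rho> x then 1 else 0))"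
      using ab by (subst mat_mult_entry[of _ m m _ m]) (auto simp: perm_mat_def intro!: sum.cong)
    also have "\<dots> = (\<Sum>x<m. if x = ?i a then if a = b then 1 else 0 else 0)"
      using ab i ir by (intro sum.cong) auto
    also have "\<dots> = 1\<^sub>m m $$ (a, b)" using ab i by simp
    finally show "(transpose_mat ?w * ?w) $$ (a, b) = 1\<^sub>m m $$ (a, b)" .
  qed (simp_all add: perm_mat_def)
  show ?thesis by (intro GL_inv_equality 1 2) simp_all
qed

text \<open>Conjugation moves the entry at \<open>(\<rho> a, \<rho> b)\<close> to \<open>(a, b)\<close>.\<close>

lemma conj_set_perm_mat:
  assumes bij: "bij_betw \<rho> {..<m} {..<m}"
  shows "conj_set m (perm_mat m \<rho>) (pattern_mats m S :: 'a::field mat set)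
    = pattern_mats m (inv_image S \<rho>)"
proof -
  let ?w = "perm_mat m \<rho> :: 'a mat"
  have r: "\<rho> a < m" if "a < m" for a using bij that by (auto simp: bij_betw_def)
  have eq: "\<rho> a = \<rho> b \<longleftrightarrow> a = b" if "a < m" "b < m" for a b
    using bij that by (auto simp: bij_betw_def inj_on_def)
  have entry: "(?w * A * transpose_mat ?w) $$ (a, b) = A $$ (\<rho> a, \<rho> b)"
    if "A \<in> carrier_mat m m" "a < m" "b < m" for A a b
    using that r by (simp add: mult_perm_mat_transpose_entry[of "?w * A" m] perm_mat_mult_entry
        mult_carrier_mat[OF perm_mat_carrier] del: index_mult_mat)
  have C: "conj_set m ?w H = {?w * A * transpose_mat ?w | A. A \<in> H}" for H
    by (simp add: conj_set_def perm_mat_inv[OF bij])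
  show ?thesis unfolding C
  proof (intro equalityI subsetI)
    fix B assume "B \<in> {?w * A * transpose_mat ?w | A. A \<in> pattern_mats m S}"
    then obtain A where A: "A \<in> pattern_mats m S" "B = ?w * A * transpose_mat ?w" by blast
    from A(1) have "A \<in> carrier_mat m m" by (rule pattern_mats_carrier)
    note e = entry[OF this]
    have "B \<in> carrier_mat m m" unfolding A(2)
      by (intro carrier_matI) (simp_all add: perm_mat_def)
    then show "B \<in> pattern_mats m (inv_image S \<rho>)"
      using pattern_mats_diag[OF A(1)] pattern_mats_off_diag[OF A(1) r r] r eq
      by (intro pattern_matsI) (auto simp: A(2) e simp del: index_mult_mat)
  next
    fix B :: "'a mat" assume B: "B \<in> pattern_mats m (inv_image S \<rho>)"
    let ?i = "inv_into {..<m} \<rho>"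
    have i: "?i a < m" "\<rho> (?i a) = a" if "a < m" for a
      using bij that by (auto simp: bij_betw_def f_inv_into_f intro!: inv_into_into[of _ \<rho> "{..<m}", simplified])
    have ieq: "?i a = ?i b \<longleftrightarrow> a = b" if "a < m" "b < m" for a b using i that by metis
    have ir: "?i (\<rho> a) = a" if "a < m" for a using bij that by (simp add: bij_betw_def)
    let ?A = "mat m m (\<lambda>(a, b). B $$ (?i a, ?i b))"
    have "?A \<in> pattern_mats m S"
    proof (rule pattern_matsI)
      show "?A $$ (a, a) = 1" if "a < m" for a
        using that i pattern_mats_diag[OF B, of "?i a"] by simp
      show "(a, b) \<in> S" if "a < m" "b < m" "a \<noteq> b" "?A $$ (a, b) \<noteq> 0" for a b
        using that i ieq pattern_mats_off_diag[OF B, of "?i a" "?i b"] by auto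
    qed simp
    moreover have "B = ?w * ?A * transpose_mat ?w"
    proof (rule eq_matI)
      fix a b assume "a < dim_row (?w * ?A * transpose_mat ?w)" "b < dim_col (?w * ?A * transpose_mat ?w)"
      then have ab: "a < m" "b < m" by (simp_all add: perm_mat_def)
      then show "B $$ (a, b) = (?w * ?A * transpose_mat ?w) $$ (a, b)"
        using r ir by (subst entry) auto
    qed (use pattern_mats_carrier[OF B] in \<open>auto simp: perm_mat_def\<close>)
    ultimately show "B \<in> {?w * A * transpose_mat ?w | A. A \<in> pattern_mats m S}" by blast
  qed
qed

section \<open>Ideals and normality\<close>

text \<open>When \<open>S\<close> absorbs compositions with \<open>T\<close> on both sides, the matrices supported on \<open>S\<close> form a
  two-sided ideal under multiplication by the group of \<open>T\<close>.  Conjugating \<open>1 + N\<close> by \<open>g\<close> gives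
  \<open>1 + g N g\<inverse>\<close>, which is again of this form.\<close>

lemma pattern_mats_conj_closed:
  assumes S: "irrefl S" and T: "trans T" "irrefl T" "T \<subseteq> {..<m} \<times> {..<m}"
    and ideal: "T O S \<subseteq> S" "S O T \<subseteq> S"
    and g: "g \<in> pattern_mats m T" and A: "A \<in> pattern_mats m S"
  shows "g * A * inv\<^bsub>GL m\<^esub> g \<in> pattern_mats m S"
proof -
  interpret G: group "GL m :: 'a mat monoid" by (rule GL_group)
  interpret T: subgroup "pattern_mats m T :: 'a mat set" "GL m" by (rule pattern_mats_subgroup[OF T])
  obtain N where N: "N \<in> pattern_space m S" "A = 1\<^sub>m m + N" using pattern_mats_decompose[OF A] .
  let ?g' = "inv\<^bsub>GL m\<^esub> g"
  have g': "?g' \<in> pattern_mats m T" using g by (rule T.m_inv_closed)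
  have c: "g \<in> carrier_mat m m" "?g' \<in> carrier_mat m m" "N \<in> carrier_mat m m"
    using g g' N(1) pattern_mats_carrier pattern_space_carrier by blast+
  have "g * ?g' = 1\<^sub>m m" using G.r_inv[OF T.mem_carrier[OF g]] by simp
  then have "g * A * ?g' = 1\<^sub>m m + g * N * ?g'"
    unfolding N(2) mult_add_distrib_mat[OF c(1) one_carrier_mat c(3)]
    using c by (simp add: add_mult_distrib_mat[of _ m m])
  moreover have "g * N * ?g' \<in> pattern_space m S"
    by (intro pattern_space_mult_right[OF g' _ ideal(2)] pattern_space_mult_left[OF g N(1) ideal(1)])
  ultimately show ?thesis using pattern_mats_add_space[OF one_in_pattern_mats _ S] by simp
qed

lemma pattern_mats_normalizes:
  assumes S: "trans S" "irrefl S" "S \<subseteq> {..<m} \<times> {..<m}"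
    and T: "trans T" "irrefl T" "T \<subseteq> {..<m} \<times> {..<m}"
    and ideal: "T O S \<subseteq> S" "S O T \<subseteq> S"
  shows "normalizes m (pattern_mats m T) (pattern_mats m S :: 'a::field mat set)"
  unfolding normalizes_def
proof
  interpret G: group "GL m :: 'a mat monoid" by (rule GL_group)
  interpret T: subgroup "pattern_mats m T :: 'a mat set" "GL m" by (rule pattern_mats_subgroup[OF T])
  interpret S: subgroup "pattern_mats m S :: 'a mat set" "GL m" by (rule pattern_mats_subgroup[OF S])
  note conj = pattern_mats_conj_closed[OF S(2) T ideal]
  fix g :: "'a mat" assume g: "g \<in> pattern_mats m T"
  show "conj_set m g (pattern_mats m S) = pattern_mats m S"
  proof (intro equalityI subsetI)
    fix B assume "B \<in> conj_set m g (pattern_mats m S)"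
    then show "B \<in> pattern_mats m S" using conj[OF g] by (auto simp: conj_set_def)
  next
    fix B :: "'a mat" assume B: "B \<in> pattern_mats m S"
    let ?g' = "inv\<^bsub>GL m\<^esub> g"
    let ?A = "?g' \<otimes>\<^bsub>GL m\<^esub> B \<otimes>\<^bsub>GL m\<^esub> g"
    have c: "g \<in> carrier (GL m)" "B \<in> carrier (GL m)" using g B by auto
    have "?A \<in> pattern_mats m S" using conj[OF T.m_inv_closed[OF g] B] c by simp
    moreover have "B = g \<otimes>\<^bsub>GL m\<^esub> ?A \<otimes>\<^bsub>GL m\<^esub> ?g'"
      using c by (simp add: G.m_assoc G.inv_solve_left' del: GL_mult GL_one)
        (simp add: G.m_assoc[symmetric] del: GL_mult GL_one)
    ultimately show "B \<in> conj_set m g (pattern_mats m S)" unfolding conj_set_def by blast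
  qed
qed

lemma trans_Un_ideal:
  assumes "trans S" "trans T" "T O S \<subseteq> S" "S O T \<subseteq> S"
  shows "trans (S \<union> T)"
  using assms by (auto intro!: transI dest: transD)

text \<open>Given \<open>A\<close> in the group of \<open>S \<union> T\<close>, let \<open>B\<close> keep the entries of \<open>A\<close> at positions in \<open>T\<close> and
  let \<open>N\<close> hold the remaining ones, which sit at positions in \<open>S\<close>.  Then
  \<open>A = N + B = (1 + N B\<inverse>) B\<close>, and \<open>N B\<inverse>\<close> is supported on \<open>S\<close> since \<open>S\<close> absorbs \<open>T\<close>.\<close>

lemma pattern_mats_set_mult:
  assumes S: "trans S" "irrefl S" and T: "trans T" "irrefl T" "T \<subseteq> {..<m} \<times> {..<m}"
    and ideal: "T O S \<subseteq> S" "S O T \<subseteq> S"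
  shows "pattern_mats m S <#>\<^bsub>GL m\<^esub> pattern_mats m T = (pattern_mats m (S \<union> T) :: 'a::field mat set)"
proof (intro equalityI subsetI)
  have ST: "trans (S \<union> T)" "irrefl (S \<union> T)"
    using S T trans_Un_ideal[OF S(1) T(1) ideal] by (auto simp: irrefl_def)
  fix A :: "'a mat" assume "A \<in> pattern_mats m S <#>\<^bsub>GL m\<^esub> pattern_mats m T"
  then obtain X Y where "A = X * Y" "X \<in> pattern_mats m S" "Y \<in> pattern_mats m T"
    by (auto simp: set_mult_def)
  then show "A \<in> pattern_mats m (S \<union> T)"
    using pattern_mats_mult[OF _ _ ST] pattern_mats_mono[of S "S \<union> T"] pattern_mats_mono[of T "S \<union> T"]
    by blast
next
  interpret G: group "GL m :: 'a mat monoid" by (rule GL_group)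
  interpret T: subgroup "pattern_mats m T :: 'a mat set" "GL m" by (rule pattern_mats_subgroup[OF T])
  fix A :: "'a mat" assume A: "A \<in> pattern_mats m (S \<union> T)"
  define B where "B = mat m m (\<lambda>(i, j). if i = j \<or> (i, j) \<in> T then A $$ (i, j) else 0)"
  define N where "N = mat m m (\<lambda>(i, j). if i = j \<or> (i, j) \<in> T then 0 else A $$ (i, j))"
  have B: "B \<in> pattern_mats m T" 
    using pattern_mats_diag[OF A] pattern_mats_off_diag[OF A]
    by (intro pattern_matsI) (auto simp: B_def split: if_splits)
  have N: "N \<in> pattern_space m S" 
    using pattern_mats_off_diag[OF A] by (intro pattern_spaceI) (auto simp: N_def split: if_splits)
  let ?B' = "inv\<^bsub>GL m\<^esub> B"
  have B': "?B' \<in> pattern_mats m T" using B by (rule T.m_inv_closed)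
  have c: "N \<in> carrier_mat m m" "B \<in> carrier_mat m m" "?B' \<in> carrier_mat m m"
    using N B B' pattern_mats_carrier pattern_space_carrier by blast+
  have inv: "?B' * B = 1\<^sub>m m" using G.l_inv[OF T.mem_carrier[OF B]] by simp
  have "(1\<^sub>m m + N * ?B') * B = B + N * (?B' * B)"
    using c by (simp add: add_mult_distrib_mat[of _ m m] assoc_mult_mat[of _ m m _ m _ m])
  also have "\<dots> = B + N" using c by (simp add: inv)
  also have "\<dots> = A" using pattern_mats_carrier[OF A] by (intro eq_matI) (auto simp: B_def N_def)
  finally have "A = (1\<^sub>m m + N * ?B') * B" ..
  moreover have "1\<^sub>m m + N * ?B' \<in> pattern_mats m S"
    by (intro pattern_mats_add_space[OF one_in_pattern_mats _ S(2)]
        pattern_space_mult_right[OF B' N ideal(2)])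
  ultimately show "A \<in> pattern_mats m S <#>\<^bsub>GL m\<^esub> pattern_mats m T"
    using B by (auto simp: set_mult_def)
qed

section \<open>Positive roots as matrix positions\<close>

text \<open>Matrix entries are counted from 0, so \<open>(a, b)\<close> with \<open>a < b\<close> is the position
  of the root on row \<open>a + 1\<close> and column \<open>b + 1\<close>.\<close>

definition root_of :: "nat \<times> nat \<Rightarrow> rt" where
  "root_of p = rt_seg (Suc (fst p)) (snd p)"

lemma lookup_rt_seg: "Poly_Mapping.lookup (rt_seg i j) t = (if i \<le> t \<and> t \<le> j then 1 else 0)"
proof -
  have "Poly_Mapping.lookup (rt_seg i j) t = (\<Sum>s = i..j. Poly_Mapping.lookup (simple_root s) t)"
    unfolding rt_seg_def by (rule lookup_sum)
  also have "\<dots> = (\<Sum>s = i..j. if s = t then 1 else 0)"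
    by (simp add: simple_root_def lookup_single when_def)
  finally show ?thesis by simp
qed

lemma rt_seg_eq_iff:
  assumes "i \<le> j" "i' \<le> j'"
  shows "rt_seg i j = rt_seg i' j' \<longleftrightarrow> i = i' \<and> j = j'"
proof
  assume eq: "rt_seg i j = rt_seg i' j'"
  have *: "i \<le> t \<and> t \<le> j \<longleftrightarrow> i' \<le> t \<and> t \<le> j'" for t
    using arg_cong[OF eq, of "\<lambda>r. Poly_Mapping.lookup r t"] by (auto simp: lookup_rt_seg split: if_splits)
  show "i = i' \<and> j = j'"
    using *[of i] *[of i'] *[of j] *[of j'] assms by auto
qed simp

lemma rt_row_root_of [simp]: "a < b \<Longrightarrow> rt_row (root_of (a, b)) = Suc a"
  unfolding rt_row_def root_of_def by (rule the_equality) (auto simp: rt_seg_eq_iff intro: exI[of _ b])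

lemma rt_col_root_of [simp]: "a < b \<Longrightarrow> rt_col (root_of (a, b)) = Suc b"
  unfolding rt_col_def root_of_def by (rule the_equality) (auto simp: rt_seg_eq_iff intro: exI[of _ "Suc a"])

lemma root_of_eq_iff: "a < b \<Longrightarrow> c < d \<Longrightarrow> root_of (a, b) = root_of (c, d) \<longleftrightarrow> a = c \<and> b = d"
  by (simp add: root_of_def rt_seg_eq_iff)

lemma pos_roots_eq: "pos_roots n = root_of ` upper n"
proof (intro equalityI subsetI)
  fix \<beta> assume "\<beta> \<in> pos_roots n"
  then obtain i j where "\<beta> = rt_seg i j" "1 \<le> i" "i \<le> j" "j \<le> n - 1" by (auto simp: pos_roots_def)
  then have "\<beta> = root_of (i - 1, j)" "(i - 1, j) \<in> upper n" by (auto simp: root_of_def)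
  then show "\<beta> \<in> root_of ` upper n" by (rule image_eqI)
next
  fix \<beta> assume "\<beta> \<in> root_of ` upper n"
  then obtain a b where "\<beta> = rt_seg (Suc a) b" "a < b" "b < n" by (auto simp: root_of_def)
  then show "\<beta> \<in> pos_roots n" unfolding pos_roots_def by (intro CollectI exI[of _ "Suc a"] exI[of _ b]) auto
qed

lemma root_of_in_pos_roots: "a < b \<Longrightarrow> root_of (a, b) \<in> pos_roots n \<longleftrightarrow> b < n"
  unfolding pos_roots_eq image_iff by (auto simp: root_of_eq_iff)

lemma root_of_add:
  assumes "a < b" "b < c"
  shows "root_of (a, b) + root_of (b, c) = root_of (a, c)"
  using assms by (intro poly_mapping_eqI) (auto simp: root_of_def lookup_add lookup_rt_seg)

text \<open>Only segments that are adjacent add up to a segment.  If they are not adjacent, the sum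
  takes the value 2 where they overlap, or it leaves a gap between them.\<close>

lemma root_of_add_in_pos_roots_iff:
  assumes ab: "a < b" "b < n" and cd: "c < d" "d < n"
  shows "root_of (a, b) + root_of (c, d) \<in> pos_roots n \<longleftrightarrow> b = c \<or> d = a"
proof
  assume "root_of (a, b) + root_of (c, d) \<in> pos_roots n"
  then obtain x y where xy: "x < y" and eq: "root_of (a, b) + root_of (c, d) = root_of (x, y)"
    by (auto simp: pos_roots_eq)
  have *: "(if a < t \<and> t \<le> b then 1 else 0) + (if c < t \<and> t \<le> d then 1 else 0)
      = (if x < t \<and> t \<le> y then 1 else 0 :: int)" for t
    using arg_cong[OF eq, of "\<lambda>r. Poly_Mapping.lookup r t"]
    by (simp add: root_of_def lookup_add lookup_rt_seg Suc_le_eq)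
  show "b = c \<or> d = a"
  proof (rule ccontr)
    (* The coefficients of the sum are inspected just before, in and after a gap, or, when the
       segments overlap, at the last place that they share. *)
    assume "\<not> (b = c \<or> d = a)"
    then consider "b < c" | "d < a" | "c < b" "a < d" using ab cd by linarith
    then show False
    proof cases
      case 1
      then show False using *[of b] *[of "Suc b"] *[of d] ab cd xy by (auto split: if_splits)
    next
      case 2
      then show False using *[of d] *[of "Suc d"] *[of b] ab cd xy by (auto split: if_splits)
    next
      case 3
      then show False using *[of "min b d"] ab cd by (auto split: if_splits)
    qed
  qed
next
  assume "b = c \<or> d = a"
  then show "root_of (a, b) + root_of (c, d) \<in> pos_roots n"
  proof
    assume "b = c"
    then show ?thesis using ab cd by (simp add: root_of_add root_of_in_pos_roots)
  next
    assume "d = a"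
    then show ?thesis using ab cd
      by (simp add: add.commute[of "root_of (a, b)"] root_of_add root_of_in_pos_roots)
  qed
qed

text \<open>Roots add up to a root when their positions compose, so closedness under such sums is
  transitivity of the set of positions.\<close>

lemma closed_roots_image:
  assumes S: "S \<subseteq> upper n" "trans S"
  shows "closed_roots n (root_of ` S)"
  unfolding closed_roots_def
proof (intro conjI ballI impI)
  show "root_of ` S \<subseteq> pos_roots n" using S(1) unfolding pos_roots_eq by (rule image_mono)
  fix \<alpha> \<beta> assume "\<alpha> \<in> root_of ` S" "\<beta> \<in> root_of ` S" and sum: "\<alpha> + \<beta> \<in> pos_roots n"
  then obtain p q where "p \<in> S" "q \<in> S" "\<alpha> = root_of p" "\<beta> = root_of q" by blast
  then obtain a b c d where p: "(a, b) \<in> S" "\<alpha> = root_of (a, b)"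
    and q: "(c, d) \<in> S" "\<beta> = root_of (c, d)"
    by (cases p, cases q) simp
  have lt: "a < b" "b < n" "c < d" "d < n" using p(1) q(1) S(1) by auto
  consider "b = c" | "d = a" using sum lt unfolding p q root_of_add_in_pos_roots_iff[OF lt] by blast
  then show "\<alpha> + \<beta> \<in> root_of ` S"
  proof cases
    case 1
    then have "(a, d) \<in> S" using S(2) p(1) q(1) by (auto dest: transD)
    moreover have "\<alpha> + \<beta> = root_of (a, d)" using 1 lt by (simp add: p q root_of_add)
    ultimately show ?thesis by simp
  next
    case 2
    then have "(c, b) \<in> S" using S(2) p(1) q(1) by (auto dest: transD)
    moreover have "\<alpha> + \<beta> = root_of (c, b)"
      using 2 lt by (simp add: p q add.commute[of "root_of (a, b)"] root_of_add)
    ultimately show ?thesis by simp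
  qed
qed

lemma root_subgroup_root_of: "a < b \<Longrightarrow> root_subgroup n (root_of (a, b)) = range (elem_mat n a b)"
  by (auto simp: root_subgroup_def)

lemma gen_by_roots_image:
  assumes S: "S \<subseteq> upper n" "trans S"
  shows "gen_by_roots n (root_of ` S) = pattern_mats n S"
proof -
  have "(\<Union>\<beta>\<in>root_of ` S. root_subgroup n \<beta>) = (\<Union>(a, b)\<in>S. range (elem_mat n a b :: 'a \<Rightarrow> _))"
    unfolding image_image using S(1) by (intro SUP_cong refl) (auto simp: root_subgroup_root_of)
  also have "\<dots> = {elem_mat n i j c | i j c. (i, j) \<in> S}" by blast
  finally have "gen_by_roots n (root_of ` S) = generate (GL n) {elem_mat n i j (c :: 'a) | i j c. (i, j) \<in> S}"
    unfolding gen_by_roots_def by simp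
  also have "\<dots> = pattern_mats n S"
    using S by (intro pattern_mats_eq_generate[symmetric] upper_irrefl[OF S(1)]) auto
  finally show ?thesis .
qed

section \<open>Ordering a basic set\<close>

text \<open>An injective key \<open>f\<close> orders a finite set linearly, and counting predecessors is a bijection
  onto an initial segment of the naturals whose inverse lists the set in ascending order.\<close>

lemma nth_wrt_enumerates:
  fixes f :: "rt \<Rightarrow> nat"
  assumes fin: "finite D" and inj: "inj_on f D" and lt: "\<And>\<sigma> \<tau>. lt \<sigma> \<tau> \<longleftrightarrow> f \<sigma> < f \<tau>"
  shows "bij_betw (\<lambda>i. nth_wrt lt D (Suc i)) {..<card D} D"
    and "\<And>i j. i < j \<Longrightarrow> j < card D \<Longrightarrow> f (nth_wrt lt D (Suc i)) < f (nth_wrt lt D (Suc j))"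
proof -
  let ?r = "\<lambda>\<tau>. card {\<sigma> \<in> D. f \<sigma> < f \<tau>}"
  let ?e = "\<lambda>i. nth_wrt lt D (Suc i)"
  have mono: "?r \<sigma> < ?r \<tau>" if "\<sigma> \<in> D" "f \<sigma> < f \<tau>" for \<sigma> \<tau>
  proof (rule psubset_card_mono)
    have "\<sigma> \<in> {\<rho> \<in> D. f \<rho> < f \<tau>}" "\<sigma> \<notin> {\<rho> \<in> D. f \<rho> < f \<sigma>}" using that by simp_all
    moreover have "{\<rho> \<in> D. f \<rho> < f \<sigma>} \<subseteq> {\<rho> \<in> D. f \<rho> < f \<tau>}" using that by auto
    ultimately show "{\<rho> \<in> D. f \<rho> < f \<sigma>} \<subset> {\<rho> \<in> D. f \<rho> < f \<tau>}" by blast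
  qed (use fin in simp)
  have injr: "inj_on ?r D"
  proof (rule inj_onI)
    fix \<sigma> \<tau> assume s: "\<sigma> \<in> D" and t: "\<tau> \<in> D" and eq: "?r \<sigma> = ?r \<tau>"
    have "\<not> f \<sigma> < f \<tau>" using mono[OF s] eq by fastforce
    moreover have "\<not> f \<tau> < f \<sigma>" using mono[OF t] eq by fastforce
    ultimately show "\<sigma> = \<tau>" using inj_onD[OF inj _ s t] by simp
  qed
  have "?r ` D \<subseteq> {..<card D}"
  proof
    fix m assume "m \<in> ?r ` D"
    then obtain \<tau> where "\<tau> \<in> D" "m = ?r \<tau>" by blast
    moreover from this have "{\<sigma> \<in> D. f \<sigma> < f \<tau>} \<subset> D" by blast
    ultimately show "m \<in> {..<card D}" using fin by (simp add: psubset_card_mono)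
  qed
  then have im: "?r ` D = {..<card D}"
    using card_image[OF injr] by (intro card_subset_eq) simp_all
  have e: "?e (?r \<tau>) = \<tau>" if "\<tau> \<in> D" for \<tau>
    unfolding nth_wrt_def lt using that injr by (intro the_equality) (auto dest: inj_onD)
  have e': "?e i \<in> D \<and> ?r (?e i) = i" if "i < card D" for i
  proof -
    have "i \<in> ?r ` D" using that im by simp
    then obtain \<tau> where \<tau>: "i = ?r \<tau>" "\<tau> \<in> D" by (rule imageE)
    then show ?thesis using e[OF \<tau>(2)] by simp
  qed
  show "bij_betw ?e {..<card D} D"
  proof (rule bij_betw_byWitness[where f' = ?r])
    show "\<forall>i\<in>{..<card D}. ?r (?e i) = i" "?e ` {..<card D} \<subseteq> D" 
      using e' by (auto simp: image_subset_iff)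
    show "\<forall>\<tau>\<in>D. ?e (?r \<tau>) = \<tau>" using e by blast
    show "?r ` D \<subseteq> {..<card D}" using im by blast
  qed
  show "f (?e i) < f (?e j)" if ij: "i < j" "j < card D" for i j
  proof (rule ccontr)
    assume n: "\<not> f (?e i) < f (?e j)"
    have i: "?e i \<in> D" "?r (?e i) = i" and j: "?e j \<in> D" "?r (?e j) = j"
      using e'[of i] e'[of j] ij by auto
    then have "f (?e i) \<noteq> f (?e j)" using inj_onD[OF inj _ i(1) j(1)] ij by force
    then have "?r (?e j) < ?r (?e i)" using n by (intro mono j(1)) simp
    then show False using i(2) j(2) ij by simp
  qed
qed

text \<open>In 0-based coordinates \<open>\<tau>\<close> number \<open>i\<close> sits at position \<open>(r i, c i)\<close>, and \<open>\<rho> a\<close> is the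
  number of the root that comes at place \<open>a\<close> when the rows are listed in ascending order.  Thus
  \<open>\<rho>\<close> is the permutation behind \<open>w_mat\<close>, and \<open>r \<circ> \<rho>\<close> is increasing.\<close>

locale basic_coordinates =
  fixes n k :: nat and D :: "rt set" and r c \<rho> :: "nat \<Rightarrow> nat"
  assumes card_D: "card D = k"
    and tau_eq: "i < k \<Longrightarrow> tau D (Suc i) = root_of (r i, c i)"
    and r_less_c: "i < k \<Longrightarrow> r i < c i"
    and c_less_n: "i < k \<Longrightarrow> c i < n"
    and c_mono: "i < j \<Longrightarrow> j < k \<Longrightarrow> c i < c j"
    and D_eq: "D = (\<lambda>i. root_of (r i, c i)) ` {..<k}"
    and bij_\<rho>: "bij_betw \<rho> {..<k} {..<k}"
    and r\<rho>_mono: "a < b \<Longrightarrow> b < k \<Longrightarrow> r (\<rho> a) < r (\<rho> b)"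
    and row_order: "a < k \<Longrightarrow> b < k \<Longrightarrow> tau D (Suc b) = nth_wrt less_b D (Suc a) \<longleftrightarrow> b = \<rho> a"

lemma basic_set_coordinates:
  assumes D: "basic_set n D"
  obtains r c \<rho> where "basic_coordinates n (card D) D r c \<rho>"
proof -
  let ?k = "card D"
  have sub: "D \<subseteq> root_of ` upper n" using D by (simp add: basic_set_def pos_roots_eq)
  moreover have "finite (upper n)" by (rule finite_subset[of _ "{..<n} \<times> {..<n}"]) auto
  ultimately have fin: "finite D" by (meson finite_imageI finite_subset)
  have inj: "inj_on rt_row D" "inj_on rt_col D"
    using D by (auto simp: basic_set_def inj_on_def)
  note T = nth_wrt_enumerates[OF fin inj(2), of less_r, OF less_r_def, folded tau_def]
  note B = nth_wrt_enumerates[OF fin inj(1), of less_b, OF less_b_def]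
  define r where "r i = rt_row (tau D (Suc i)) - 1" for i
  define c where "c i = rt_col (tau D (Suc i)) - 1" for i
  define \<rho> where "\<rho> a = inv_into {..<?k} (\<lambda>i. tau D (Suc i)) (nth_wrt less_b D (Suc a))" for a
  have coord: "tau D (Suc i) = root_of (r i, c i) \<and> r i < c i \<and> c i < n" if i: "i < ?k" for i
  proof -
    have "tau D (Suc i) \<in> D" using T(1) i by (auto dest: bij_betwE)
    then obtain a b where ab: "tau D (Suc i) = root_of (a, b)" "a < b" "b < n" using sub by auto
    then have "r i = a" "c i = b" by (simp_all add: r_def c_def)
    then show ?thesis using ab by simp
  qed
  have bij\<rho>: "bij_betw \<rho> {..<?k} {..<?k}"
    using bij_betw_trans[OF B(1) bij_betw_inv_into[OF T(1)]] by (simp add: \<rho>_def[abs_def] comp_def)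
  then have \<rho>k: "\<rho> a < ?k" if "a < ?k" for a using that by (auto dest: bij_betwE)
  have tau\<rho>: "tau D (Suc (\<rho> a)) = nth_wrt less_b D (Suc a)" if "a < ?k" for a
  proof -
    have "nth_wrt less_b D (Suc a) \<in> D" using B(1) that by (auto dest: bij_betwE)
    then show ?thesis unfolding \<rho>_def by (rule bij_betw_inv_into_right[OF T(1)])
  qed
  have "basic_coordinates n ?k D r c \<rho>"
  proof
    show "c i < c j" if "i < j" "j < ?k" for i j
      using T(2)[OF that] coord[of i] coord[of j] that by simp
    show "D = (\<lambda>i. root_of (r i, c i)) ` {..<?k}"
    proof -
      have "D = (\<lambda>i. tau D (Suc i)) ` {..<?k}" using T(1) by (simp add: bij_betw_def)
      also have "\<dots> = (\<lambda>i. root_of (r i, c i)) ` {..<?k}"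
        using coord by (intro image_cong refl) simp
      finally show ?thesis .
    qed
    show "r (\<rho> a) < r (\<rho> b)" if "a < b" "b < ?k" for a b
    proof -
      have "rt_row (tau D (Suc (\<rho> a))) < rt_row (tau D (Suc (\<rho> b)))"
        using B(2)[OF that] tau\<rho> that by simp
      then show ?thesis using coord[OF \<rho>k] that by simp
    qed
    show "tau D (Suc b) = nth_wrt less_b D (Suc a) \<longleftrightarrow> b = \<rho> a" if "a < ?k" "b < ?k" for a b
      unfolding tau\<rho>[OF that(1), symmetric]
      using bij_betw_imp_inj_on[OF T(1)] that(2) \<rho>k[OF that(1)] by (auto dest: inj_onD)
  qed (use coord bij\<rho> in auto)
  then show thesis by (rule that)
qed

section \<open>The groups attached to a basic set\<close>

lemma trans_map_prod_image:
  assumes inj: "inj_on f {..<k}" and S: "S \<subseteq> {..<k} \<times> {..<k}" "trans S"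
  shows "trans (map_prod f f ` S)"
proof (rule transI)
  fix x y z assume "(x, y) \<in> map_prod f f ` S" "(y, z) \<in> map_prod f f ` S"
  then obtain p q where "(x, y) = map_prod f f p" "p \<in> S" "(y, z) = map_prod f f q" "q \<in> S"
    by (elim imageE)
  then obtain a b b' c where ab: "(a, b) \<in> S" "x = f a" "y = f b"
    and bc: "(b', c) \<in> S" "y = f b'" "z = f c"
    by (cases p, cases q) simp
  have "b < k" "b' < k" using ab(1) bc(1) S(1) by auto
  then have "b = b'" using inj_onD[OF inj, of b b'] ab(3) bc(2) by simp
  then have "(a, c) \<in> S" using ab(1) bc(1) S(2) by (auto dest: transD)
  then show "(x, z) \<in> map_prod f f ` S" unfolding ab(2) bc(3) by (rule map_prod_imageI)
qed

lemma arm_root_of: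
  assumes "a < b"
  shows "arm (root_of (a, b)) = {root_of (a, y) | y. a < y \<and> y < b}"
proof (intro equalityI subsetI)
  fix \<beta> assume "\<beta> \<in> arm (root_of (a, b))"
  then obtain i j y where *: "\<beta> = rt_seg i y" "root_of (a, b) = rt_seg i j" "i \<le> y" "y < j"
    by (auto simp: arm_def)
  then have "i = Suc a" "j = b" using assms by (simp_all add: root_of_def rt_seg_eq_iff)
  then show "\<beta> \<in> {root_of (a, y) | y. a < y \<and> y < b}" using * by (auto simp: root_of_def)
next
  fix \<beta> assume "\<beta> \<in> {root_of (a, y) | y. a < y \<and> y < b}"
  then obtain y where "\<beta> = rt_seg (Suc a) y" "Suc a \<le> y" "y < b" by (auto simp: root_of_def)
  then show "\<beta> \<in> arm (root_of (a, b))" unfolding arm_def root_of_def by auto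
qed

context basic_coordinates
begin

abbreviation rank_row :: "nat \<Rightarrow> nat" where
  "rank_row \<equiv> r \<circ> \<rho>"

lemma \<rho>_less: "a < k \<Longrightarrow> \<rho> a < k"
  using bij_\<rho> by (auto dest: bij_betwE)

lemma \<rho>_surj: "i < k \<Longrightarrow> \<exists>a<k. \<rho> a = i"
  using bij_\<rho> unfolding bij_betw_def by (metis imageE lessThan_iff)

lemma r_less_n: "i < k \<Longrightarrow> r i < n"
  using r_less_c c_less_n less_trans by blast

lemma r\<rho>_less_iff: "a < k \<Longrightarrow> b < k \<Longrightarrow> r (\<rho> a) < r (\<rho> b) \<longleftrightarrow> a < b"
  using r\<rho>_mono[of a b] r\<rho>_mono[of b a] by (cases a b rule: linorder_cases) auto

lemma rank_row_inj: "inj_on rank_row {..<k}"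
proof (rule inj_onI)
  fix a b assume "a \<in> {..<k}" "b \<in> {..<k}" "rank_row a = rank_row b"
  then show "a = b" using r\<rho>_less_iff[of a b] r\<rho>_less_iff[of b a] by simp
qed

lemma r_eqD: "i < k \<Longrightarrow> j < k \<Longrightarrow> r i = r j \<Longrightarrow> i = j"
  using \<rho>_surj[of i] \<rho>_surj[of j] by (auto simp: inj_on_eq_iff[OF rank_row_inj, simplified])

lemma rt_row_tau: "i < k \<Longrightarrow> rt_row (tau D (Suc i)) = Suc (r i)"
  by (simp add: tau_eq r_less_c)

lemma gamma_ex_iff: "gamma_ex D (Suc i) (Suc j) \<longleftrightarrow> i < j \<and> j < k \<and> r i < r j"
  by (auto simp: gamma_ex_def less_b_def card_D rt_row_tau)

lemma nu_ex_iff: "nu_ex D (Suc i) (Suc j) \<longleftrightarrow> i < j \<and> j < k \<and> r j < r i"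
  by (auto simp: nu_ex_def less_b_def card_D rt_row_tau)

text \<open>A root on row \<open>x\<close> completes \<open>\<tau>\<close> to a root by ending where \<open>\<tau>\<close> starts; it cannot start
  where \<open>\<tau>\<close> ends, because it starts on an earlier row than \<open>\<tau>\<close>.\<close>

lemma completing_root:
  assumes i: "i < k" and x: "x < r i"
  shows "(THE \<gamma>. \<gamma> \<in> pos_roots n \<and> rt_row \<gamma> = Suc x \<and> \<gamma> + tau D (Suc i) \<in> pos_roots n)
    = root_of (x, r i)"
proof (rule the_equality)
  note lt = r_less_c[OF i] c_less_n[OF i]
  show "root_of (x, r i) \<in> pos_roots n \<and> rt_row (root_of (x, r i)) = Suc x
      \<and> root_of (x, r i) + tau D (Suc i) \<in> pos_roots n"
    using x lt r_less_n[OF i] by (simp add: tau_eq[OF i] root_of_in_pos_roots root_of_add)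
  fix \<gamma> assume \<gamma>: "\<gamma> \<in> pos_roots n \<and> rt_row \<gamma> = Suc x \<and> \<gamma> + tau D (Suc i) \<in> pos_roots n"
  then obtain a b where ab: "\<gamma> = root_of (a, b)" "a < b" "b < n" by (auto simp: pos_roots_eq)
  then have a: "a = x" using \<gamma> by simp
  have "b = r i \<or> c i = a"
    using \<gamma> root_of_add_in_pos_roots_iff[OF ab(2,3) lt] by (simp add: ab(1) tau_eq[OF i])
  then show "\<gamma> = root_of (x, r i)" using a ab(1) x lt by auto
qed

lemma gamma_eq: "i < j \<Longrightarrow> j < k \<Longrightarrow> r i < r j \<Longrightarrow> gamma n D (Suc i) (Suc j) = root_of (r i, r j)"
  unfolding gamma_def by (simp add: rt_row_tau completing_root)

lemma nu_eq: "i < j \<Longrightarrow> j < k \<Longrightarrow> r j < r i \<Longrightarrow> nu n D (Suc i) (Suc j) = root_of (r j, r i)"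
  unfolding nu_def by (simp add: rt_row_tau completing_root)

text \<open>Ranks instead of rows: the order on \<open>{..<k}\<close> and the order induced by \<open>\<rho>\<close> either agree or
  disagree on a pair of ranks, and this decides whether the pair belongs to a \<open>\<gamma>\<close> or a \<open>\<nu>\<close>.\<close>

definition agree :: "(nat \<times> nat) set" where
  "agree = {(a, b). a < b \<and> b < k \<and> \<rho> a < \<rho> b}"

definition disagree :: "(nat \<times> nat) set" where
  "disagree = {(a, b). a < b \<and> b < k \<and> \<rho> b < \<rho> a}"

lemma agree_un_disagree: "agree \<union> disagree = upper k"
proof -
  have "\<rho> a < \<rho> b \<or> \<rho> b < \<rho> a" if "a < b" "b < k" for a b
    using r\<rho>_mono[OF that] by (metis less_irrefl linorder_neqE_nat)
  then show ?thesis by (auto simp: agree_def disagree_def)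
qed

lemma rank_row_image_cases:
  assumes "q \<in> map_prod rank_row rank_row ` S"
  obtains a b where "(a, b) \<in> S" "q = (r (\<rho> a), r (\<rho> b))"
proof -
  from assms obtain p where p: "q = map_prod rank_row rank_row p" "p \<in> S" by (rule imageE)
  show thesis by (rule that[of "fst p" "snd p"]) (use p in \<open>simp_all add: map_prod_def split_beta\<close>)
qed

lemma rank_row_root_cases:
  assumes "\<beta> \<in> root_of ` map_prod rank_row rank_row ` S"
  obtains a b where "(a, b) \<in> S" "\<beta> = root_of (r (\<rho> a), r (\<rho> b))"
proof -
  from assms obtain q where q: "\<beta> = root_of q" "q \<in> map_prod rank_row rank_row ` S" by (rule imageE)
  from q(2) show thesis by (rule rank_row_image_cases) (use q(1) in \<open>auto intro: that\<close>)
qed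

lemma Gamma_set_eq: "Gamma_set n D = root_of ` map_prod rank_row rank_row ` agree"
proof (intro equalityI subsetI)
  fix \<beta> assume "\<beta> \<in> Gamma_set n D"
  then obtain i' j' where ij': "gamma_ex D i' j'" "\<beta> = gamma n D i' j'" by (auto simp: Gamma_set_def)
  then obtain i j where "i' = Suc i" "j' = Suc j"
    by (cases i'; cases j') (auto simp: gamma_ex_def)
  then have ij: "i < j" "j < k" "r i < r j" and \<beta>: "\<beta> = root_of (r i, r j)"
    using ij' by (auto simp: gamma_ex_iff gamma_eq)
  obtain a b where ab: "a < k" "b < k" "\<rho> a = i" "\<rho> b = j"
    using \<rho>_surj[of i] \<rho>_surj[of j] ij by auto
  then have "(a, b) \<in> agree" using ij r\<rho>_less_iff[of a b] by (simp add: agree_def)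
  moreover have "\<beta> = root_of (map_prod rank_row rank_row (a, b))" using ab \<beta> by simp
  ultimately show "\<beta> \<in> root_of ` map_prod rank_row rank_row ` agree" by blast
next
  fix \<beta> assume "\<beta> \<in> root_of ` map_prod rank_row rank_row ` agree"
  then obtain a b where ab: "(a, b) \<in> agree" "\<beta> = root_of (r (\<rho> a), r (\<rho> b))"
    by (rule rank_row_root_cases)
  then have *: "a < b" "b < k" "\<rho> a < \<rho> b" by (simp_all add: agree_def)
  then have "gamma_ex D (Suc (\<rho> a)) (Suc (\<rho> b))"
    and "\<beta> = gamma n D (Suc (\<rho> a)) (Suc (\<rho> b))"
    using ab(2) \<rho>_less r\<rho>_mono by (simp_all add: gamma_ex_iff gamma_eq)
  then show "\<beta> \<in> Gamma_set n D" unfolding Gamma_set_def by blast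
qed

lemma Lambda_set_eq: "Lambda_set n D = root_of ` map_prod rank_row rank_row ` disagree"
proof (intro equalityI subsetI)
  fix \<beta> assume "\<beta> \<in> Lambda_set n D"
  then obtain i' j' where ij': "nu_ex D i' j'" "\<beta> = nu n D i' j'" by (auto simp: Lambda_set_def)
  then obtain i j where "i' = Suc i" "j' = Suc j"
    by (cases i'; cases j') (auto simp: nu_ex_def)
  then have ij: "i < j" "j < k" "r j < r i" and \<beta>: "\<beta> = root_of (r j, r i)"
    using ij' by (auto simp: nu_ex_iff nu_eq)
  obtain a b where ab: "a < k" "b < k" "\<rho> a = j" "\<rho> b = i"
    using \<rho>_surj[of i] \<rho>_surj[of j] ij by auto
  then have "(a, b) \<in> disagree" using ij r\<rho>_less_iff[of a b] by (simp add: disagree_def)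
  moreover have "\<beta> = root_of (map_prod rank_row rank_row (a, b))" using ab \<beta> by simp
  ultimately show "\<beta> \<in> root_of ` map_prod rank_row rank_row ` disagree" by blast
next
  fix \<beta> assume "\<beta> \<in> root_of ` map_prod rank_row rank_row ` disagree"
  then obtain a b where ab: "(a, b) \<in> disagree" "\<beta> = root_of (r (\<rho> a), r (\<rho> b))"
    by (rule rank_row_root_cases)
  then have *: "a < b" "b < k" "\<rho> b < \<rho> a" by (simp_all add: disagree_def)
  then have "nu_ex D (Suc (\<rho> b)) (Suc (\<rho> a))"
    and "\<beta> = nu n D (Suc (\<rho> b)) (Suc (\<rho> a))"
    using ab(2) \<rho>_less r\<rho>_mono by (simp_all add: nu_ex_iff nu_eq)
  then show "\<beta> \<in> Lambda_set n D" unfolding Lambda_set_def by blast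
qed

lemma Delta_set_eq: "Delta_set n D = root_of ` map_prod rank_row rank_row ` upper k"
  unfolding Delta_set_def Gamma_set_eq Lambda_set_eq agree_un_disagree[symmetric]
  by (simp only: image_Un)

lemma map_prod_rank_row_upper:
  assumes "S \<subseteq> upper k"
  shows "map_prod rank_row rank_row ` S \<subseteq> upper n"
proof
  fix q assume "q \<in> map_prod rank_row rank_row ` S"
  then obtain a b where ab: "(a, b) \<in> S" "q = (r (\<rho> a), r (\<rho> b))" by (rule rank_row_image_cases)
  then have "a < b" "b < k" using assms by auto
  then show "q \<in> upper n" using ab(2) r\<rho>_mono r_less_n \<rho>_less by simp
qed

text \<open>Since \<open>rank_row\<close> is increasing, an order on the ranks that is contained in \<open><\<close> becomes an order of
  the same kind on the matrix indices.\<close>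

lemma rank_pattern:
  assumes S: "S \<subseteq> upper k" "trans S"
  shows "closed_roots n (root_of ` map_prod rank_row rank_row ` S)"
    and "gen_by_roots n (root_of ` map_prod rank_row rank_row ` S) = pattern_mats n (map_prod rank_row rank_row ` S)"
    and "GL_restrict n (gen_by_roots n (root_of ` map_prod rank_row rank_row ` S) :: 'a::field mat set)
      \<cong> GL_restrict k (pattern_mats k S :: 'a mat set)"
proof -
  have S': "S \<subseteq> {..<k} \<times> {..<k}" using S(1) by auto
  note up = map_prod_rank_row_upper[OF S(1)] trans_map_prod_image[OF rank_row_inj S' S(2)]
  show "closed_roots n (root_of ` map_prod rank_row rank_row ` S)" by (rule closed_roots_image[OF up])
  show "gen_by_roots n (root_of ` map_prod rank_row rank_row ` S) = (pattern_mats n (map_prod rank_row rank_row ` S) :: 'b::field mat set)"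
    by (rule gen_by_roots_image[OF up])
  have "rank_row ` {..<k} \<subseteq> {..<n}" using r_less_n \<rho>_less by auto
  then show "GL_restrict n (gen_by_roots n (root_of ` map_prod rank_row rank_row ` S) :: 'a mat set)
      \<cong> GL_restrict k (pattern_mats k S :: 'a mat set)"
    unfolding gen_by_roots_image[OF up] by (rule pattern_mats_reindex_iso[OF rank_row_inj _ S'])
qed

lemma upper_pattern: "upper k \<subseteq> upper k" "trans (upper k)"
  by (auto intro!: transI)

lemma agree_pattern: "agree \<subseteq> upper k" "trans agree"
  by (auto simp: agree_def intro!: transI)

lemma disagree_pattern: "disagree \<subseteq> upper k" "trans disagree"
  by (auto simp: disagree_def intro!: transI)

text \<open>A sum of two \<open>\<gamma>\<close>s is a root only if one ends on the row where the other begins, and rows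
  determine the indices.  If the root of the pair \<open>(j, t)\<close> ended where that of \<open>(i, s)\<close> begins,
  then \<open>t = i\<close>, against \<open>i < j < t\<close>.\<close>

lemma gamma_sum:
  assumes "1 \<le> i" "i < j" and ex: "gamma_ex D i s" "gamma_ex D j t"
    and sum: "gamma n D i s + gamma n D j t \<in> pos_roots n"
  shows "s = j \<and> gamma_ex D i t \<and> gamma n D i j + gamma n D j t = gamma n D i t"
proof -
  obtain i' j' s' t' where S: "i = Suc i'" "j = Suc j'" "s = Suc s'" "t = Suc t'"
    using assms by (cases i; cases j; cases s; cases t) (auto simp: gamma_ex_def)
  have ip: "i' < s'" "s' < k" "r i' < r s'" and jt: "j' < t'" "t' < k" "r j' < r t'"
    using ex unfolding S gamma_ex_iff by simp_all
  have ij: "i' < j'" using assms(2) S by simp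
  have "r s' = r j' \<or> r t' = r i'"
    using sum root_of_add_in_pos_roots_iff[OF ip(3) r_less_n jt(3) r_less_n] ip jt
    unfolding S gamma_eq[OF ip] gamma_eq[OF jt] by simp
  then have s: "s' = j'" using r_eqD[of s' j'] r_eqD[of t' i'] ip jt ij by auto
  have it: "i' < t'" "t' < k" "r i' < r t'" using ip jt ij unfolding s by simp_all
  have "gamma_ex D i t" unfolding S gamma_ex_iff using it by simp
  moreover have "gamma n D i j + gamma n D j t = gamma n D i t"
    unfolding S gamma_eq[OF ip[unfolded s]] gamma_eq[OF jt] gamma_eq[OF it]
    by (rule root_of_add[OF ip(3)[unfolded s] jt(3)])
  ultimately show ?thesis using s S by simp
qed

lemma nu_sum:
  assumes "1 \<le> i" "i < j" and ex: "nu_ex D i s" "nu_ex D j t"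
    and sum: "nu n D i s + nu n D j t \<in> pos_roots n"
  shows "s = j \<and> nu_ex D i t \<and> nu n D i j + nu n D j t = nu n D i t"
proof -
  obtain i' j' s' t' where S: "i = Suc i'" "j = Suc j'" "s = Suc s'" "t = Suc t'"
    using assms by (cases i; cases j; cases s; cases t) (auto simp: nu_ex_def)
  have ip: "i' < s'" "s' < k" "r s' < r i'" and jt: "j' < t'" "t' < k" "r t' < r j'"
    using ex unfolding S nu_ex_iff by simp_all
  have ij: "i' < j'" using assms(2) S by simp
  have "r i' = r t' \<or> r j' = r s'"
    using sum root_of_add_in_pos_roots_iff[OF ip(3) r_less_n jt(3) r_less_n] ip jt ij
    unfolding S nu_eq[OF ip] nu_eq[OF jt] by simp
  then have s: "s' = j'" using r_eqD[of j' s'] r_eqD[of i' t'] ip jt ij by auto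
  have it: "i' < t'" "t' < k" "r t' < r i'" using ip jt ij unfolding s by simp_all
  have "nu_ex D i t" unfolding S nu_ex_iff using it by simp
  moreover have "nu n D i j + nu n D j t = nu n D i t"
    unfolding S nu_eq[OF ip[unfolded s]] nu_eq[OF jt] nu_eq[OF it] add.commute[of "root_of (r j', r i')"]
    by (rule root_of_add[OF jt(3) ip(3)[unfolded s]])
  ultimately show ?thesis using s S by simp
qed

lemma w_mat_eq: "w_mat D = perm_mat k \<rho>"
  unfolding w_mat_def perm_mat_def card_D by (intro cong_mat refl) (simp add: row_order)

lemma unitri_conj_w: "unitri k \<inter> conj_set k (w_mat D) (unitri k) = pattern_mats k agree"
proof -
  have "upper k \<inter> inv_image (upper k) \<rho> = agree" using \<rho>_less by (auto simp: agree_def inv_image_def)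
  then show ?thesis
    by (simp add: unitri_eq_pattern_mats w_mat_eq conj_set_perm_mat[OF bij_\<rho>] pattern_mats_Int)
qed

text \<open>Multiplying \<open>w\<close> by \<open>w\<^sub>0\<close> precomposes \<open>\<rho>\<close> with the reversal of \<open>{..<k}\<close>.  On reversed
  ranks the two conditions \<open>a < b\<close> and \<open>\<rho> (rev a) < \<rho> (rev b)\<close> describe the converse of
  the disagreement order, which is why inverse transposition enters.\<close>

lemma disagree_iso_unitri_conj_w0_w:
  "GL_restrict k (pattern_mats k disagree :: 'a::field mat set)
    \<cong> GL_restrict k (unitri k \<inter> conj_set k (w0_mat k \<otimes>\<^bsub>GL k\<^esub> w_mat D) (unitri k) :: 'a mat set)"
proof -
  define rv where "rv a = k - 1 - a" for a
  have rv: "rv a < k" "rv (rv a) = a" if "a < k" for a using that by (auto simp: rv_def)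
  have rvlt: "rv a < rv b \<longleftrightarrow> b < a" if "a < k" "b < k" for a b using that by (auto simp: rv_def)
  have bij: "bij_betw rv {..<k} {..<k}" by (rule bij_betw_byWitness[where f' = rv]) (use rv in auto)
  define T where "T = upper k \<inter> inv_image (upper k) (\<rho> \<circ> rv)"
  have "w0_mat k = (perm_mat k rv :: 'a mat)"
    unfolding w0_mat_def perm_mat_def rv_def by (intro cong_mat refl) auto
  then have w: "w0_mat k \<otimes>\<^bsub>GL k\<^esub> w_mat D = (perm_mat k (\<rho> \<circ> rv) :: 'a mat)"
    by (simp add: w_mat_eq perm_mat_mult[OF bij])
  have target: "unitri k \<inter> conj_set k (w0_mat k \<otimes>\<^bsub>GL k\<^esub> w_mat D) (unitri k) = (pattern_mats k T :: 'a mat set)"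
    unfolding w unitri_eq_pattern_mats conj_set_perm_mat[OF bij_betw_trans[OF bij bij_\<rho>]] T_def
    by (rule pattern_mats_Int)
  have "map_prod rv rv ` T = disagree\<inverse>"
  proof (intro equalityI subsetI)
    fix q assume "q \<in> map_prod rv rv ` T"
    then obtain p where p: "q = map_prod rv rv p" "p \<in> T" by (rule imageE)
    obtain a b where ab: "p = (a, b)" by (cases p)
    then have "a < b" "b < k" "\<rho> (rv a) < \<rho> (rv b)" using p(2) by (auto simp: T_def inv_image_def)
    then show "q \<in> disagree\<inverse>" using p(1) rv rvlt by (simp add: ab disagree_def)
  next
    fix q assume "q \<in> disagree\<inverse>"
    then obtain x y where q: "q = (x, y)" "y < x" "x < k" "\<rho> x < \<rho> y" by (auto simp: disagree_def)
    then have "(rv x, rv y) \<in> T" using rv rvlt \<rho>_less by (simp add: T_def inv_image_def)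
    moreover have "q = map_prod rv rv (rv x, rv y)" using q rv by simp
    ultimately show "q \<in> map_prod rv rv ` T" by (rule rev_image_eqI)
  qed
  moreover have "T \<subseteq> {..<k} \<times> {..<k}" by (auto simp: T_def)
  moreover have "inj_on rv {..<k}" "rv ` {..<k} \<subseteq> {..<k}" using bij by (auto simp: bij_betw_def)
  ultimately have "GL_restrict k (pattern_mats k (disagree\<inverse>) :: 'a mat set)
      \<cong> GL_restrict k (pattern_mats k T :: 'a mat set)"
    using pattern_mats_reindex_iso[of rv k k T] by simp
  moreover have "GL_restrict k (pattern_mats k disagree :: 'a mat set)
      \<cong> GL_restrict k (pattern_mats k (disagree\<inverse>) :: 'a mat set)"
    using disagree_pattern upper_irrefl[OF disagree_pattern(1)]
    by (intro pattern_mats_converse_iso) auto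
  ultimately show ?thesis unfolding target by (rule iso_trans[rotated])
qed

definition off_arms :: "(nat \<times> nat) set" where
  "off_arms = {(x, y). x < y \<and> y < n \<and> (\<forall>i<k. r i = x \<longrightarrow> c i \<le> y)}"

lemma off_arms_roots: "pos_roots n - (\<Union>\<alpha>\<in>D. arm \<alpha>) = root_of ` off_arms"
proof -
  have in_arm: "root_of (x, y) \<in> (\<Union>\<alpha>\<in>D. arm \<alpha>) \<longleftrightarrow> (\<exists>i<k. r i = x \<and> y < c i)"
    if "x < y" for x y
  proof -
    have arm: "root_of (x, y) \<in> arm (root_of (r i, c i)) \<longleftrightarrow> r i = x \<and> y < c i" if i: "i < k" for i
    proof
      assume "root_of (x, y) \<in> arm (root_of (r i, c i))"
      then obtain y' where "root_of (x, y) = root_of (r i, y')" "r i < y'" "y' < c i"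
        unfolding arm_root_of[OF r_less_c[OF i]] by blast
      then show "r i = x \<and> y < c i" using \<open>x < y\<close> by (simp add: root_of_eq_iff)
    qed (use \<open>x < y\<close> arm_root_of[OF r_less_c[OF i]] in auto)
    have "root_of (x, y) \<in> (\<Union>\<alpha>\<in>D. arm \<alpha>) \<longleftrightarrow> (\<exists>i<k. root_of (x, y) \<in> arm (root_of (r i, c i)))"
      unfolding D_eq by auto
    also have "\<dots> \<longleftrightarrow> (\<exists>i<k. r i = x \<and> y < c i)"
      using arm by blast
    finally show ?thesis .
  qed
  show ?thesis
  proof (intro equalityI subsetI)
    fix \<beta> assume \<beta>: "\<beta> \<in> pos_roots n - (\<Union>\<alpha>\<in>D. arm \<alpha>)"
    then obtain x y where xy: "\<beta> = root_of (x, y)" "x < y" "y < n" by (auto simp: pos_roots_eq)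
    have "\<not> (\<exists>i<k. r i = x \<and> y < c i)" using \<beta> in_arm[OF xy(2)] unfolding xy(1) by simp
    then have "(x, y) \<in> off_arms" using xy(2,3) by (auto simp: off_arms_def not_less)
    then show "\<beta> \<in> root_of ` off_arms" unfolding xy(1) by (rule imageI)
  next
    fix \<beta> assume "\<beta> \<in> root_of ` off_arms"
    then obtain p where p: "\<beta> = root_of p" "p \<in> off_arms" by (rule imageE)
    obtain x y where xy: "p = (x, y)" by (cases p)
    then have lt: "x < y" "y < n" and "\<And>i. i < k \<Longrightarrow> r i = x \<Longrightarrow> c i \<le> y"
      using p(2) by (simp_all add: off_arms_def)
    then have "\<not> (\<exists>i<k. r i = x \<and> y < c i)" by fastforce
    then show "\<beta> \<in> pos_roots n - (\<Union>\<alpha>\<in>D. arm \<alpha>)"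
      using in_arm[OF lt(1)] lt by (simp add: p(1) xy root_of_in_pos_roots)
  qed
qed

lemma off_arms_pattern: "off_arms \<subseteq> upper n" "trans off_arms"
proof -
  show "off_arms \<subseteq> upper n" by (auto simp: off_arms_def)
  show "trans off_arms" by (rule transI) (fastforce simp: off_arms_def)
qed

text \<open>A position of \<open>\<Gamma>\<close> moves the row from \<open>r j\<close> up to \<open>r i\<close> with \<open>i < j\<close>, where the arm
  ends further left since \<open>c i < c j\<close>; composing on the other side only moves further to the right.
  Hence the complement of the arms absorbs \<open>\<Gamma>\<close>.\<close>

lemma off_arms_ideal:
  "map_prod rank_row rank_row ` agree O off_arms \<subseteq> off_arms" "off_arms O map_prod rank_row rank_row ` agree \<subseteq> off_arms"
proof -
  have G: "\<exists>i j. p = (r i, r j) \<and> i < j \<and> j < k \<and> r i < r j" if "p \<in> map_prod rank_row rank_row ` agree" for p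
  proof -
    from that obtain a b where ab: "(a, b) \<in> agree" "p = (r (\<rho> a), r (\<rho> b))"
      by (rule rank_row_image_cases)
    then have "a < b" "b < k" "\<rho> a < \<rho> b" by (simp_all add: agree_def)
    then show ?thesis using ab(2) \<rho>_less r\<rho>_mono by (intro exI[of _ "\<rho> a"] exI[of _ "\<rho> b"]) simp
  qed
  show "map_prod rank_row rank_row ` agree O off_arms \<subseteq> off_arms"
  proof (rule subsetI, elim relcompE)
    fix p x y z assume "(x, y) \<in> map_prod rank_row rank_row ` agree" and V: "(y, z) \<in> off_arms" and p: "p = (x, z)"
    then obtain i j where ij: "x = r i" "y = r j" "i < j" "j < k" "r i < r j" using G by blast
    have V': "r j < z" "z < n" "c j \<le> z" using V ij by (auto simp: off_arms_def)
    moreover have "c i < z" using c_mono[OF ij(3,4)] V'(3) by simp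
    ultimately show "p \<in> off_arms" using ij r_eqD[of _ i] unfolding p off_arms_def by force
  qed
  show "off_arms O map_prod rank_row rank_row ` agree \<subseteq> off_arms"
  proof (rule subsetI, elim relcompE)
    fix p x y z assume V: "(x, y) \<in> off_arms" and "(y, z) \<in> map_prod rank_row rank_row ` agree" and p: "p = (x, z)"
    then obtain i j where "y = r i" "z = r j" "i < j" "j < k" "r i < r j" using G by blast
    then have "y < z" "z < n" using r_less_n by simp_all
    then show "p \<in> off_arms" using V unfolding p off_arms_def by fastforce
  qed
qed

lemma off_arms_un_agree_pattern:
  "off_arms \<union> map_prod rank_row rank_row ` agree \<subseteq> upper n" "trans (off_arms \<union> map_prod rank_row rank_row ` agree)"
proof -
  let ?G = "map_prod rank_row rank_row ` agree"
  show "off_arms \<union> ?G \<subseteq> upper n" using off_arms_pattern(1) map_prod_rank_row_upper[OF agree_pattern(1)] by simp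
  have "agree \<subseteq> {..<k} \<times> {..<k}" using agree_pattern(1) by auto
  then have "trans ?G" by (rule trans_map_prod_image[OF rank_row_inj _ agree_pattern(2)])
  then show "trans (off_arms \<union> ?G)"
    by (rule trans_Un_ideal[OF off_arms_pattern(2) _ off_arms_ideal])
qed

lemma V_grp_eq: "V_grp n D = pattern_mats n off_arms"
  unfolding V_grp_def off_arms_roots by (rule gen_by_roots_image[OF off_arms_pattern])

lemma R_grp_eq: "R_grp n D = pattern_mats n (map_prod rank_row rank_row ` agree)"
  unfolding R_grp_def Gamma_set_eq by (rule rank_pattern[OF agree_pattern])

lemma agree_rows_pattern: "trans (map_prod rank_row rank_row ` agree)" "irrefl (map_prod rank_row rank_row ` agree)"
    "map_prod rank_row rank_row ` agree \<subseteq> {..<n} \<times> {..<n}"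
proof -
  have "agree \<subseteq> {..<k} \<times> {..<k}" using agree_pattern(1) by auto
  then show "trans (map_prod rank_row rank_row ` agree)" by (rule trans_map_prod_image[OF rank_row_inj _ agree_pattern(2)])
  note up = map_prod_rank_row_upper[OF agree_pattern(1)]
  show "irrefl (map_prod rank_row rank_row ` agree)" by (rule upper_irrefl[OF up])
  show "map_prod rank_row rank_row ` agree \<subseteq> {..<n} \<times> {..<n}" using up by auto
qed

lemma V_R_pattern_subgroup: "pattern_subgroup n (V_grp n D <#>\<^bsub>GL n\<^esub> R_grp n D)"
proof -
  have "V_grp n D <#>\<^bsub>GL n\<^esub> R_grp n D = pattern_mats n (off_arms \<union> map_prod rank_row rank_row ` agree)"
    unfolding V_grp_eq R_grp_eq
    by (rule pattern_mats_set_mult[OF off_arms_pattern(2) upper_irrefl[OF off_arms_pattern(1)]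
          agree_rows_pattern off_arms_ideal])
  also have "\<dots> = gen_by_roots n (root_of ` (off_arms \<union> map_prod rank_row rank_row ` agree))"
    by (rule gen_by_roots_image[OF off_arms_un_agree_pattern, symmetric])
  finally show ?thesis
    unfolding pattern_subgroup_def using closed_roots_image[OF off_arms_un_agree_pattern] by blast
qed

lemma R_normalizes_V: "normalizes n (R_grp n D) (V_grp n D)"
proof -
  have "off_arms \<subseteq> {..<n} \<times> {..<n}" using off_arms_pattern(1) by auto
  then show ?thesis unfolding V_grp_eq R_grp_eq
    by (rule pattern_mats_normalizes[OF off_arms_pattern(2) upper_irrefl[OF off_arms_pattern(1)] _
          agree_rows_pattern off_arms_ideal])
qed

end

theorem lemma2p7:
  fixes n k :: nat and D :: "rt set"
  assumes n: "2 \<le> n"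
    and D: "basic_set n D"
    and k: "card D = k"
  shows
    "(closed_roots n (Delta_set n D) \<and>
     GL_restrict n (gen_by_roots n (Delta_set n D) :: 'a::{field,finite} mat set)
       \<cong> GL_restrict k (unitri k :: 'a mat set)) \<and>
     (closed_roots n (Gamma_set n D) \<and>
     (\<forall>i j s r. 1 \<le> i \<and> i < j \<and> j \<le> k \<and> gamma_ex D i s \<and> gamma_ex D j r \<and>
        gamma n D i s + gamma n D j r \<in> pos_roots n \<longrightarrow>
        s = j \<and> gamma_ex D i r \<and> gamma n D i j + gamma n D j r = gamma n D i r)) \<and>
     (closed_roots n (Lambda_set n D) \<and>
     (\<forall>i j s r. 1 \<le> i \<and> i < j \<and> j \<le> k \<and> nu_ex D i s \<and> nu_ex D j r \<and>
        nu n D i s + nu n D j r \<in> pos_roots n \<longrightarrow>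
        s = j \<and> nu_ex D i r \<and> nu n D i j + nu n D j r = nu n D i r)) \<and>
     (GL_restrict n (R_grp n D :: 'a mat set)
       \<cong> GL_restrict k (unitri k \<inter> conj_set k (w_mat D) (unitri k) :: 'a mat set) \<and>
     GL_restrict n (C_grp n D :: 'a mat set)
       \<cong> GL_restrict k (unitri k \<inter>
            conj_set k (w0_mat k \<otimes>\<^bsub>GL k\<^esub> w_mat D) (unitri k) :: 'a mat set)) \<and>
     (pattern_subgroup n (V_grp n D <#>\<^bsub>GL n\<^esub> R_grp n D :: 'a mat set) \<and>
     normalizes n (R_grp n D :: 'a mat set) (V_grp n D))"
proof -
  obtain rw cl \<rho> where "basic_coordinates n k D rw cl \<rho>"
    using basic_set_coordinates[OF D] unfolding k by blast
  then interpret basic_coordinates n k D rw cl \<rho> .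
  have i: "closed_roots n (Delta_set n D)"
    "GL_restrict n (gen_by_roots n (Delta_set n D) :: 'a mat set) \<cong> GL_restrict k (unitri k :: 'a mat set)"
    unfolding Delta_set_eq unitri_eq_pattern_mats by (rule rank_pattern[OF upper_pattern])+
  have ii: "closed_roots n (Gamma_set n D)"
    unfolding Gamma_set_eq by (rule rank_pattern[OF agree_pattern])
  have iii: "closed_roots n (Lambda_set n D)"
    unfolding Lambda_set_eq by (rule rank_pattern[OF disagree_pattern])
  have R: "GL_restrict n (R_grp n D :: 'a mat set)
       \<cong> GL_restrict k (unitri k \<inter> conj_set k (w_mat D) (unitri k) :: 'a mat set)"
    unfolding R_grp_def Gamma_set_eq unitri_conj_w by (rule rank_pattern[OF agree_pattern])
  have "GL_restrict n (C_grp n D :: 'a mat set) \<cong> GL_restrict k (pattern_mats k disagree :: 'a mat set)"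
    unfolding C_grp_def Lambda_set_eq by (rule rank_pattern[OF disagree_pattern])
  note C = iso_trans[OF this disagree_iso_unitri_conj_w0_w]
  have gs: "\<forall>i j s t. 1 \<le> i \<and> i < j \<and> j \<le> k \<and> gamma_ex D i s \<and> gamma_ex D j t \<and>
        gamma n D i s + gamma n D j t \<in> pos_roots n \<longrightarrow>
        s = j \<and> gamma_ex D i t \<and> gamma n D i j + gamma n D j t = gamma n D i t"
    using gamma_sum by blast
  have ns: "\<forall>i j s t. 1 \<le> i \<and> i < j \<and> j \<le> k \<and> nu_ex D i s \<and> nu_ex D j t \<and>
        nu n D i s + nu n D j t \<in> pos_roots n \<longrightarrow>
        s = j \<and> nu_ex D i t \<and> nu n D i j + nu n D j t = nu n D i t"
    using nu_sum by blast
  show ?thesis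
    by (intro conjI i ii iii R C gs ns V_R_pattern_subgroup R_normalizes_V)
qed

end
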